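(* $\mathsf{RCA}_0$ proves that every Dedekind--Hasse domain is a ($\Sigma^0_1$-)PID, i.e. every countable integral domain admitting a Dedekind--Hasse norm is an integral domain in which every $\Sigma^0_1$-ideal is principal.
   Context: $\mathsf{RCA}_0$: basic arithmetic, $\Sigma^0_1$-induction, $\Delta^0_1$-comprehension. A Dedekind--Hasse norm on an integral domain $R$ is a function $f:R\to\mathbb{N}$ such that (i) $f(r)=0$ iff $r=0$; (ii) for all nonzero $a,b\in R$, either $b\mid a$ or there exist $x,y\in R$ with $0<f(ax+by)<f(b)$; (iii) for all nonzero $a,b$, $f(a)\le f(ab)$. A $\Sigma^0_1$-ideal is a sequence $\langle a_0,a_1,\ldots\rangle$ in $R$ such that for all $i,j,r,s$ some $a_k=a_ir+a_js$, with membership $r\in\mathcal{I}$ iff $\exists m\,r=a_m$; it is principal if it equals (by mutual inclusion) $(c)=\{cr:r\in R\}$ for some $c$. *)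

theory Defs
  imports Main
begin

section \<open>Second-order arithmetic: syntax\<close>

text \<open>
  The language \<open>L\<^sub>2\<close>, with de Bruijn indices. Number variables and set variables are indexed
  independently: \<open>All\<close> binds number index 0, \<open>AllS\<close> binds set index 0. Equality is primitive for
  numbers only.
\<close>

datatype tm = Var nat | Zero | One | Add tm tm | Mul tm tm

datatype fm =
    Eq tm tm   (infix \<open>\<^bold>=\<close> 55)
  | Lt tm tm   (infix \<open>\<^bold><\<close> 55)
  | Mem tm nat (infix \<open>\<^bold>\<in>\<close> 55)
  | Fls        (\<open>\<^bold>\<bottom>\<close>)
  | Imp fm fm  (infixr \<open>\<^bold>\<longrightarrow>\<close> 45)
  | All fm
  | AllS fm

abbreviation Neg :: "fm \<Rightarrow> fm" (\<open>\<^bold>\<not> _\<close> [54] 54) where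
  "\<^bold>\<not> \<phi> \<equiv> \<phi> \<^bold>\<longrightarrow> \<^bold>\<bottom>"

abbreviation Dis :: "fm \<Rightarrow> fm \<Rightarrow> fm" (infixr \<open>\<^bold>\<or>\<close> 48) where
  "\<phi> \<^bold>\<or> \<psi> \<equiv> \<^bold>\<not> \<phi> \<^bold>\<longrightarrow> \<psi>"

abbreviation Con :: "fm \<Rightarrow> fm \<Rightarrow> fm" (infixr \<open>\<^bold>\<and>\<close> 50) where
  "\<phi> \<^bold>\<and> \<psi> \<equiv> \<^bold>\<not> (\<phi> \<^bold>\<longrightarrow> \<^bold>\<not> \<psi>)"

abbreviation Iff :: "fm \<Rightarrow> fm \<Rightarrow> fm" (infix \<open>\<^bold>\<longleftrightarrow>\<close> 44) where
  "\<phi> \<^bold>\<longleftrightarrow> \<psi> \<equiv> (\<phi> \<^bold>\<longrightarrow> \<psi>) \<^bold>\<and> (\<psi> \<^bold>\<longrightarrow> \<phi>)"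

abbreviation Ex :: "fm \<Rightarrow> fm" where "Ex \<phi> \<equiv> \<^bold>\<not> All (\<^bold>\<not> \<phi>)"
abbreviation ExS :: "fm \<Rightarrow> fm" where "ExS \<phi> \<equiv> \<^bold>\<not> AllS (\<^bold>\<not> \<phi>)"

primrec substt :: "(nat \<Rightarrow> tm) \<Rightarrow> tm \<Rightarrow> tm" where
  "substt \<sigma> (Var i) = \<sigma> i"
| "substt \<sigma> Zero = Zero"
| "substt \<sigma> One = One"
| "substt \<sigma> (Add s t) = Add (substt \<sigma> s) (substt \<sigma> t)"
| "substt \<sigma> (Mul s t) = Mul (substt \<sigma> s) (substt \<sigma> t)"

abbreviation shiftt :: "tm \<Rightarrow> tm" where
  "shiftt \<equiv> substt (\<lambda>i. Var (Suc i))"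

text \<open>
  Parallel substitution of terms (\<open>\<sigma>\<close>) for number variables and of set variables (\<open>\<rho>\<close>) for set
  variables; it is capture-avoiding, since \<open>\<sigma>\<close> and \<open>\<rho>\<close> are lifted under binders.
\<close>

primrec subst :: "(nat \<Rightarrow> tm) \<Rightarrow> (nat \<Rightarrow> nat) \<Rightarrow> fm \<Rightarrow> fm" where
  "subst \<sigma> \<rho> (s \<^bold>= t) = (substt \<sigma> s \<^bold>= substt \<sigma> t)"
| "subst \<sigma> \<rho> (s \<^bold>< t) = (substt \<sigma> s \<^bold>< substt \<sigma> t)"
| "subst \<sigma> \<rho> (t \<^bold>\<in> X) = (substt \<sigma> t \<^bold>\<in> \<rho> X)"
| "subst \<sigma> \<rho> \<^bold>\<bottom> = \<^bold>\<bottom>"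
| "subst \<sigma> \<rho> (\<phi> \<^bold>\<longrightarrow> \<psi>) = (subst \<sigma> \<rho> \<phi> \<^bold>\<longrightarrow> subst \<sigma> \<rho> \<psi>)"
| "subst \<sigma> \<rho> (All \<phi>) = All (subst (case_nat (Var 0) (\<lambda>i. shiftt (\<sigma> i))) \<rho> \<phi>)"
| "subst \<sigma> \<rho> (AllS \<phi>) = AllS (subst \<sigma> (case_nat 0 (\<lambda>i. Suc (\<rho> i))) \<phi>)"

abbreviation shift :: "fm \<Rightarrow> fm" where
  "shift \<equiv> subst (\<lambda>i. Var (Suc i)) (\<lambda>i. i)"

abbreviation shiftS :: "fm \<Rightarrow> fm" where
  "shiftS \<equiv> subst Var Suc"

abbreviation inst :: "tm \<Rightarrow> fm \<Rightarrow> fm" where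
  "inst t \<equiv> subst (case_nat t Var) (\<lambda>i. i)"

abbreviation instS :: "nat \<Rightarrow> fm \<Rightarrow> fm" where
  "instS X \<equiv> subst Var (case_nat X (\<lambda>i. i))"

primrec fvt :: "tm \<Rightarrow> nat set" where
  "fvt (Var i) = {i}"
| "fvt Zero = {}"
| "fvt One = {}"
| "fvt (Add s t) = fvt s \<union> fvt t"
| "fvt (Mul s t) = fvt s \<union> fvt t"

primrec fv :: "fm \<Rightarrow> nat set" where
  "fv (s \<^bold>= t) = fvt s \<union> fvt t"
| "fv (s \<^bold>< t) = fvt s \<union> fvt t"
| "fv (t \<^bold>\<in> X) = fvt t"
| "fv \<^bold>\<bottom> = {}"
| "fv (\<phi> \<^bold>\<longrightarrow> \<psi>) = fv \<phi> \<union> fv \<psi>"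
| "fv (All \<phi>) = {i. Suc i \<in> fv \<phi>}"
| "fv (AllS \<phi>) = fv \<phi>"

primrec fvS :: "fm \<Rightarrow> nat set" where
  "fvS (s \<^bold>= t) = {}"
| "fvS (s \<^bold>< t) = {}"
| "fvS (t \<^bold>\<in> X) = {X}"
| "fvS \<^bold>\<bottom> = {}"
| "fvS (\<phi> \<^bold>\<longrightarrow> \<psi>) = fvS \<phi> \<union> fvS \<psi>"
| "fvS (All \<phi>) = fvS \<phi>"
| "fvS (AllS \<phi>) = {i. Suc i \<in> fvS \<phi>}"

definition sentence :: "fm \<Rightarrow> bool" where
  "sentence \<phi> \<longleftrightarrow> fv \<phi> = {} \<and> fvS \<phi> = {}"


section \<open>Derivability\<close>

text \<open>
  Classical two-sorted natural deduction with equality on the number sort. The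
  eigenvariable condition of the two generalisation rules is expressed by shifting the hypotheses.
\<close>

inductive derives :: "fm set \<Rightarrow> fm \<Rightarrow> bool" (infix \<open>\<turnstile>\<close> 40) where
  Assm: "\<phi> \<in> \<Gamma> \<Longrightarrow> \<Gamma> \<turnstile> \<phi>"
| ImpI: "insert \<phi> \<Gamma> \<turnstile> \<psi> \<Longrightarrow> \<Gamma> \<turnstile> \<phi> \<^bold>\<longrightarrow> \<psi>"
| ImpE: "\<Gamma> \<turnstile> \<phi> \<^bold>\<longrightarrow> \<psi> \<Longrightarrow> \<Gamma> \<turnstile> \<phi> \<Longrightarrow> \<Gamma> \<turnstile> \<psi>"
| Raa: "insert (\<^bold>\<not> \<phi>) \<Gamma> \<turnstile> \<^bold>\<bottom> \<Longrightarrow> \<Gamma> \<turnstile> \<phi>"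
| AllI: "shift ` \<Gamma> \<turnstile> \<phi> \<Longrightarrow> \<Gamma> \<turnstile> All \<phi>"
| AllE: "\<Gamma> \<turnstile> All \<phi> \<Longrightarrow> \<Gamma> \<turnstile> inst t \<phi>"
| AllSI: "shiftS ` \<Gamma> \<turnstile> \<phi> \<Longrightarrow> \<Gamma> \<turnstile> AllS \<phi>"
| AllSE: "\<Gamma> \<turnstile> AllS \<phi> \<Longrightarrow> \<Gamma> \<turnstile> instS X \<phi>"
| EqI: "\<Gamma> \<turnstile> t \<^bold>= t"
| EqE: "\<Gamma> \<turnstile> s \<^bold>= t \<Longrightarrow> \<Gamma> \<turnstile> inst s \<phi> \<Longrightarrow> \<Gamma> \<turnstile> inst t \<phi>"


section \<open>Named quantifiers\<close>

text \<open>
  \<open>\<^bold>\<forall>x. \<phi>\<close> binds the variable whose index is \<open>x\<close> at the outermost level of \<open>\<phi>\<close>; all other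
  variables keep their name. This permits writing concrete formulas with named variables.
\<close>

definition alln :: "nat \<Rightarrow> fm \<Rightarrow> fm" (\<open>\<^bold>\<forall>_. _\<close> [60, 42] 42) where
  "(\<^bold>\<forall>x. \<phi>) = All (subst (\<lambda>i. Var (if i = x then 0 else Suc i)) (\<lambda>i. i) \<phi>)"

definition alls :: "nat \<Rightarrow> fm \<Rightarrow> fm" (\<open>\<^bold>\<forall>\<^sub>S_. _\<close> [60, 42] 42) where
  "(\<^bold>\<forall>\<^sub>SX. \<phi>) = AllS (subst Var (\<lambda>i. if i = X then 0 else Suc i) \<phi>)"

abbreviation exn :: "nat \<Rightarrow> fm \<Rightarrow> fm" (\<open>\<^bold>\<exists>_. _\<close> [60, 42] 42) where
  "(\<^bold>\<exists>x. \<phi>) \<equiv> \<^bold>\<not> (\<^bold>\<forall>x. \<^bold>\<not> \<phi>)"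

abbreviation exs :: "nat \<Rightarrow> fm \<Rightarrow> fm" (\<open>\<^bold>\<exists>\<^sub>S_. _\<close> [60, 42] 42) where
  "(\<^bold>\<exists>\<^sub>SX. \<phi>) \<equiv> \<^bold>\<not> (\<^bold>\<forall>\<^sub>SX. \<^bold>\<not> \<phi>)"

abbreviation alln_in :: "nat \<Rightarrow> nat \<Rightarrow> fm \<Rightarrow> fm" (\<open>\<^bold>\<forall>_\<^bold>\<in>_. _\<close> [60, 60, 42] 42) where
  "(\<^bold>\<forall>x\<^bold>\<in>X. \<phi>) \<equiv> \<^bold>\<forall>x. (Var x \<^bold>\<in> X \<^bold>\<longrightarrow> \<phi>)"

abbreviation exn_in :: "nat \<Rightarrow> nat \<Rightarrow> fm \<Rightarrow> fm" (\<open>\<^bold>\<exists>_\<^bold>\<in>_. _\<close> [60, 60, 42] 42) where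
  "(\<^bold>\<exists>x\<^bold>\<in>X. \<phi>) \<equiv> \<^bold>\<exists>x. (Var x \<^bold>\<in> X \<^bold>\<and> \<phi>)"

abbreviation (input) \<a> :: nat where "\<a> \<equiv> 0"
abbreviation (input) \<b> :: nat where "\<b> \<equiv> 1"
abbreviation (input) \<c> :: nat where "\<c> \<equiv> 2"
abbreviation (input) \<d> :: nat where "\<d> \<equiv> 3"
abbreviation (input) \<i> :: nat where "\<i> \<equiv> 4"
abbreviation (input) \<j> :: nat where "\<j> \<equiv> 5"
abbreviation (input) \<k> :: nat where "\<k> \<equiv> 6"
abbreviation (input) \<m> :: nat where "\<m> \<equiv> 7"
abbreviation (input) \<n> :: nat where "\<n> \<equiv> 8"
abbreviation (input) \<p> :: nat where "\<p> \<equiv> 9"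
abbreviation (input) \<r> :: nat where "\<r> \<equiv> 10"
abbreviation (input) \<s> :: nat where "\<s> \<equiv> 11"
abbreviation (input) \<u> :: nat where "\<u> \<equiv> 12"
abbreviation (input) \<v> :: nat where "\<v> \<equiv> 13"
abbreviation (input) \<w> :: nat where "\<w> \<equiv> 14"
abbreviation (input) \<x> :: nat where "\<x> \<equiv> 15"
abbreviation (input) \<y> :: nat where "\<y> \<equiv> 16"

text \<open>
  The names \<open>\<z>\<close>, \<open>\<e>\<close> are reserved for the zero and the unit of a ring; \<open>\<R>\<close>, \<open>\<A>\<close>, \<open>\<N>\<close>, \<open>\<M>\<close> for
  its underlying set, addition, negation and multiplication; \<open>\<F>\<close> for a norm; \<open>\<I>\<close> for a sequence.
\<close>

abbreviation (input) \<z> :: nat where "\<z> \<equiv> 17"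
abbreviation (input) \<e> :: nat where "\<e> \<equiv> 18"

abbreviation (input) \<R> :: nat where "\<R> \<equiv> 0"
abbreviation (input) \<A> :: nat where "\<A> \<equiv> 1"
abbreviation (input) \<N> :: nat where "\<N> \<equiv> 2"
abbreviation (input) \<M> :: nat where "\<M> \<equiv> 3"
abbreviation (input) \<F> :: nat where "\<F> \<equiv> 4"
abbreviation (input) \<I> :: nat where "\<I> \<equiv> 5"


section \<open>The theory RCA0\<close>

inductive_set Sigma00 :: "fm set" where
  "(s \<^bold>= t) \<in> Sigma00"
| "(s \<^bold>< t) \<in> Sigma00"
| "(t \<^bold>\<in> X) \<in> Sigma00"
| "\<^bold>\<bottom> \<in> Sigma00"
| "\<phi> \<in> Sigma00 \<Longrightarrow> \<psi> \<in> Sigma00 \<Longrightarrow> (\<phi> \<^bold>\<longrightarrow> \<psi>) \<in> Sigma00"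
| "\<phi> \<in> Sigma00 \<Longrightarrow> All (Var 0 \<^bold>< shiftt t \<^bold>\<longrightarrow> \<phi>) \<in> Sigma00"
| "\<phi> \<in> Sigma00 \<Longrightarrow> Ex (Var 0 \<^bold>< shiftt t \<^bold>\<and> \<phi>) \<in> Sigma00"

definition Sigma01 :: "fm set" where "Sigma01 = Ex ` Sigma00"
definition Pi01 :: "fm set" where "Pi01 = All ` Sigma00"

definition basic_axioms :: "fm set" where
  "basic_axioms =
    {\<^bold>\<forall>\<n>. \<^bold>\<not> (Add (Var \<n>) One \<^bold>= Zero),
     \<^bold>\<forall>\<m>. \<^bold>\<forall>\<n>. (Add (Var \<m>) One \<^bold>= Add (Var \<n>) One \<^bold>\<longrightarrow> Var \<m> \<^bold>= Var \<n>),
     \<^bold>\<forall>\<m>. (Add (Var \<m>) Zero \<^bold>= Var \<m>),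
     \<^bold>\<forall>\<m>. \<^bold>\<forall>\<n>. (Add (Var \<m>) (Add (Var \<n>) One) \<^bold>= Add (Add (Var \<m>) (Var \<n>)) One),
     \<^bold>\<forall>\<m>. (Mul (Var \<m>) Zero \<^bold>= Zero),
     \<^bold>\<forall>\<m>. \<^bold>\<forall>\<n>. (Mul (Var \<m>) (Add (Var \<n>) One) \<^bold>= Add (Mul (Var \<m>) (Var \<n>)) (Var \<m>)),
     \<^bold>\<forall>\<m>. \<^bold>\<not> (Var \<m> \<^bold>< Zero),
     \<^bold>\<forall>\<m>. \<^bold>\<forall>\<n>. (Var \<m> \<^bold>< Add (Var \<n>) One \<^bold>\<longleftrightarrow> (Var \<m> \<^bold>< Var \<n> \<^bold>\<or> Var \<m> \<^bold>= Var \<n>))}"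

text \<open>In both schemes the distinguished number variable of \<open>\<phi>\<close> and \<open>\<psi>\<close> is index 0.\<close>

definition induction_axiom :: "fm \<Rightarrow> fm" where
  "induction_axiom \<phi> =
    (inst Zero \<phi> \<^bold>\<and>
     All (\<phi> \<^bold>\<longrightarrow> subst (case_nat (Add (Var 0) One) (\<lambda>i. Var (Suc i))) (\<lambda>i. i) \<phi>)
     \<^bold>\<longrightarrow> All \<phi>)"

definition comprehension_axiom :: "fm \<Rightarrow> fm \<Rightarrow> fm" where
  "comprehension_axiom \<phi> \<psi> =
    (All (\<phi> \<^bold>\<longleftrightarrow> \<psi>) \<^bold>\<longrightarrow> ExS (All (Var 0 \<^bold>\<in> 0 \<^bold>\<longleftrightarrow> shiftS \<phi>)))"

definition closures :: "fm \<Rightarrow> fm set" where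
  "closures \<phi> = {\<chi>. \<exists>k l. \<chi> = (AllS ^^ l) ((All ^^ k) \<phi>) \<and> sentence \<chi>}"

definition RCA0 :: "fm set" where
  "RCA0 = basic_axioms
    \<union> (\<Union>\<phi> \<in> Sigma01. closures (induction_axiom \<phi>))
    \<union> (\<Union>\<phi> \<in> Sigma01. \<Union>\<psi> \<in> Pi01. closures (comprehension_axiom \<phi> \<psi>))"


section \<open>Countable rings in second-order arithmetic\<close>

text \<open>Pairs are coded by \<open>(i, j) = (i + j)\<^sup>2 + i\<close>, which is a term of the language.\<close>

definition pr :: "tm \<Rightarrow> tm \<Rightarrow> tm" where
  "pr s t = Add (Mul (Add s t) (Add s t)) s"

text \<open>A function is the set of codes of the pairs in its graph.\<close>

definition app1 :: "nat \<Rightarrow> nat \<Rightarrow> nat \<Rightarrow> fm" where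
  "app1 F x y = (pr (Var x) (Var y) \<^bold>\<in> F)"

definition app2 :: "nat \<Rightarrow> nat \<Rightarrow> nat \<Rightarrow> nat \<Rightarrow> fm" where
  "app2 F x y z = (pr (pr (Var x) (Var y)) (Var z) \<^bold>\<in> F)"

text \<open>
  \<open>F\<close> is a function from \<open>{x. D x}\<close> to \<open>{y. C y}\<close>, where \<open>D\<close>, \<open>C\<close> map a variable name to a formula.
\<close>

definition is_function :: "nat \<Rightarrow> (nat \<Rightarrow> fm) \<Rightarrow> (nat \<Rightarrow> fm) \<Rightarrow> fm" where
  "is_function F D C =
    ((\<^bold>\<forall>\<p>\<^bold>\<in>F. \<^bold>\<exists>\<x>. \<^bold>\<exists>\<y>. (Var \<p> \<^bold>= pr (Var \<x>) (Var \<y>) \<^bold>\<and> D \<x> \<^bold>\<and> C \<y>)) \<^bold>\<and>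
     (\<^bold>\<forall>\<x>. (D \<x> \<^bold>\<longrightarrow> (\<^bold>\<exists>\<y>. app1 F \<x> \<y>))) \<^bold>\<and>
     (\<^bold>\<forall>\<x>. \<^bold>\<forall>\<u>. \<^bold>\<forall>\<v>. (app1 F \<x> \<u> \<^bold>\<and> app1 F \<x> \<v> \<^bold>\<longrightarrow> Var \<u> \<^bold>= Var \<v>)))"

definition inR :: "nat \<Rightarrow> fm" where "inR x = (Var x \<^bold>\<in> \<R>)"

definition inRR :: "nat \<Rightarrow> fm" where
  "inRR x = (\<^bold>\<exists>\<a>\<^bold>\<in>\<R>. \<^bold>\<exists>\<b>\<^bold>\<in>\<R>. (Var x \<^bold>= pr (Var \<a>) (Var \<b>)))"

definition inNat :: "nat \<Rightarrow> fm" where "inNat x = (Var x \<^bold>= Var x)"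

definition is_comm_ring :: fm where
  "is_comm_ring =
    (inR \<z> \<^bold>\<and> inR \<e> \<^bold>\<and>
     is_function \<A> inRR inR \<^bold>\<and> is_function \<N> inR inR \<^bold>\<and> is_function \<M> inRR inR \<^bold>\<and>
     (\<^bold>\<forall>\<a>\<^bold>\<in>\<R>. \<^bold>\<forall>\<b>\<^bold>\<in>\<R>. \<^bold>\<forall>\<c>\<^bold>\<in>\<R>. \<^bold>\<forall>\<u>\<^bold>\<in>\<R>. \<^bold>\<forall>\<v>\<^bold>\<in>\<R>. \<^bold>\<forall>\<w>\<^bold>\<in>\<R>.
        (app2 \<A> \<a> \<b> \<u> \<^bold>\<and> app2 \<A> \<u> \<c> \<w> \<^bold>\<and> app2 \<A> \<b> \<c> \<v> \<^bold>\<longrightarrow> app2 \<A> \<a> \<v> \<w>)) \<^bold>\<and>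
     (\<^bold>\<forall>\<a>\<^bold>\<in>\<R>. \<^bold>\<forall>\<b>\<^bold>\<in>\<R>. \<^bold>\<forall>\<u>\<^bold>\<in>\<R>. (app2 \<A> \<a> \<b> \<u> \<^bold>\<longrightarrow> app2 \<A> \<b> \<a> \<u>)) \<^bold>\<and>
     (\<^bold>\<forall>\<a>\<^bold>\<in>\<R>. app2 \<A> \<a> \<z> \<a>) \<^bold>\<and>
     (\<^bold>\<forall>\<a>\<^bold>\<in>\<R>. \<^bold>\<forall>\<u>\<^bold>\<in>\<R>. (app1 \<N> \<a> \<u> \<^bold>\<longrightarrow> app2 \<A> \<a> \<u> \<z>)) \<^bold>\<and>
     (\<^bold>\<forall>\<a>\<^bold>\<in>\<R>. \<^bold>\<forall>\<b>\<^bold>\<in>\<R>. \<^bold>\<forall>\<c>\<^bold>\<in>\<R>. \<^bold>\<forall>\<u>\<^bold>\<in>\<R>. \<^bold>\<forall>\<v>\<^bold>\<in>\<R>. \<^bold>\<forall>\<w>\<^bold>\<in>\<R>.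
        (app2 \<M> \<a> \<b> \<u> \<^bold>\<and> app2 \<M> \<u> \<c> \<w> \<^bold>\<and> app2 \<M> \<b> \<c> \<v> \<^bold>\<longrightarrow> app2 \<M> \<a> \<v> \<w>)) \<^bold>\<and>
     (\<^bold>\<forall>\<a>\<^bold>\<in>\<R>. \<^bold>\<forall>\<b>\<^bold>\<in>\<R>. \<^bold>\<forall>\<u>\<^bold>\<in>\<R>. (app2 \<M> \<a> \<b> \<u> \<^bold>\<longrightarrow> app2 \<M> \<b> \<a> \<u>)) \<^bold>\<and>
     (\<^bold>\<forall>\<a>\<^bold>\<in>\<R>. app2 \<M> \<a> \<e> \<a>) \<^bold>\<and>
     (\<^bold>\<forall>\<a>\<^bold>\<in>\<R>. \<^bold>\<forall>\<b>\<^bold>\<in>\<R>. \<^bold>\<forall>\<c>\<^bold>\<in>\<R>. \<^bold>\<forall>\<u>\<^bold>\<in>\<R>. \<^bold>\<forall>\<v>\<^bold>\<in>\<R>. \<^bold>\<forall>\<w>\<^bold>\<in>\<R>. \<^bold>\<forall>\<x>\<^bold>\<in>\<R>.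
        (app2 \<A> \<b> \<c> \<u> \<^bold>\<and> app2 \<M> \<a> \<u> \<x> \<^bold>\<and> app2 \<M> \<a> \<b> \<v> \<^bold>\<and> app2 \<M> \<a> \<c> \<w>
         \<^bold>\<longrightarrow> app2 \<A> \<v> \<w> \<x>)))"

definition is_integral_domain :: fm where
  "is_integral_domain =
    (is_comm_ring \<^bold>\<and>
     \<^bold>\<not> (Var \<z> \<^bold>= Var \<e>) \<^bold>\<and>
     (\<^bold>\<forall>\<a>\<^bold>\<in>\<R>. \<^bold>\<forall>\<b>\<^bold>\<in>\<R>. (app2 \<M> \<a> \<b> \<z> \<^bold>\<longrightarrow> Var \<a> \<^bold>= Var \<z> \<^bold>\<or> Var \<b> \<^bold>= Var \<z>)))"

text \<open>The value of \<open>ax + by\<close> is \<open>w\<close>; the names \<open>\<u>\<close> and \<open>\<v>\<close> must not be passed as arguments.\<close>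

definition lincomb :: "nat \<Rightarrow> nat \<Rightarrow> nat \<Rightarrow> nat \<Rightarrow> nat \<Rightarrow> fm" where
  "lincomb a x b y w =
    (\<^bold>\<exists>\<u>\<^bold>\<in>\<R>. \<^bold>\<exists>\<v>\<^bold>\<in>\<R>. (app2 \<M> a x \<u> \<^bold>\<and> app2 \<M> b y \<v> \<^bold>\<and> app2 \<A> \<u> \<v> w))"

definition is_DH_norm :: fm where
  "is_DH_norm =
    (is_function \<F> inR inNat \<^bold>\<and>
     (\<^bold>\<forall>\<r>\<^bold>\<in>\<R>. (pr (Var \<r>) Zero \<^bold>\<in> \<F> \<^bold>\<longleftrightarrow> Var \<r> \<^bold>= Var \<z>)) \<^bold>\<and>
     (\<^bold>\<forall>\<a>\<^bold>\<in>\<R>. \<^bold>\<forall>\<b>\<^bold>\<in>\<R>. (\<^bold>\<not> (Var \<a> \<^bold>= Var \<z>) \<^bold>\<and> \<^bold>\<not> (Var \<b> \<^bold>= Var \<z>) \<^bold>\<longrightarrow>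
        (\<^bold>\<exists>\<x>\<^bold>\<in>\<R>. app2 \<M> \<b> \<x> \<a>) \<^bold>\<or>
        (\<^bold>\<exists>\<x>\<^bold>\<in>\<R>. \<^bold>\<exists>\<y>\<^bold>\<in>\<R>. \<^bold>\<exists>\<w>\<^bold>\<in>\<R>. \<^bold>\<exists>\<m>. \<^bold>\<exists>\<n>.
           (lincomb \<a> \<x> \<b> \<y> \<w> \<^bold>\<and> app1 \<F> \<w> \<m> \<^bold>\<and> app1 \<F> \<b> \<n> \<^bold>\<and>
            Zero \<^bold>< Var \<m> \<^bold>\<and> Var \<m> \<^bold>< Var \<n>)))) \<^bold>\<and>
     (\<^bold>\<forall>\<a>\<^bold>\<in>\<R>. \<^bold>\<forall>\<b>\<^bold>\<in>\<R>. (\<^bold>\<not> (Var \<a> \<^bold>= Var \<z>) \<^bold>\<and> \<^bold>\<not> (Var \<b> \<^bold>= Var \<z>) \<^bold>\<longrightarrow>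
        (\<^bold>\<forall>\<c>\<^bold>\<in>\<R>. \<^bold>\<forall>\<m>. \<^bold>\<forall>\<n>. (app2 \<M> \<a> \<b> \<c> \<^bold>\<and> app1 \<F> \<a> \<m> \<^bold>\<and> app1 \<F> \<c> \<n> \<^bold>\<longrightarrow>
           Var \<m> \<^bold>< Var \<n> \<^bold>\<or> Var \<m> \<^bold>= Var \<n>)))))"

definition is_DH_domain :: fm where
  "is_DH_domain = (is_integral_domain \<^bold>\<and> (\<^bold>\<exists>\<^sub>S\<F>. is_DH_norm))"

definition is_Sigma01_ideal :: fm where
  "is_Sigma01_ideal =
    (is_function \<I> inNat inR \<^bold>\<and>
     (\<^bold>\<forall>\<i>. \<^bold>\<forall>\<j>. \<^bold>\<forall>\<r>\<^bold>\<in>\<R>. \<^bold>\<forall>\<s>\<^bold>\<in>\<R>. \<^bold>\<exists>\<k>. \<^bold>\<exists>\<a>\<^bold>\<in>\<R>. \<^bold>\<exists>\<b>\<^bold>\<in>\<R>. \<^bold>\<exists>\<c>\<^bold>\<in>\<R>.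
        (app1 \<I> \<i> \<a> \<^bold>\<and> app1 \<I> \<j> \<b> \<^bold>\<and> app1 \<I> \<k> \<c> \<^bold>\<and> lincomb \<a> \<r> \<b> \<s> \<c>)))"

definition in_ideal :: "nat \<Rightarrow> fm" where
  "in_ideal x = (\<^bold>\<exists>\<m>. app1 \<I> \<m> x)"

definition in_principal :: "nat \<Rightarrow> nat \<Rightarrow> fm" where
  "in_principal c x = (\<^bold>\<exists>\<r>\<^bold>\<in>\<R>. app2 \<M> c \<r> x)"

definition ideal_is_principal :: fm where
  "ideal_is_principal =
    (\<^bold>\<exists>\<c>\<^bold>\<in>\<R>. ((\<^bold>\<forall>\<x>\<^bold>\<in>\<R>. (in_ideal \<x> \<^bold>\<longrightarrow> in_principal \<c> \<x>)) \<^bold>\<and>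
             (\<^bold>\<forall>\<x>\<^bold>\<in>\<R>. (in_principal \<c> \<x> \<^bold>\<longrightarrow> in_ideal \<x>))))"

definition is_Sigma01_PID :: fm where
  "is_Sigma01_PID =
    (is_integral_domain \<^bold>\<and> (\<^bold>\<forall>\<^sub>S\<I>. (is_Sigma01_ideal \<^bold>\<longrightarrow> ideal_is_principal)))"

definition every_DH_domain_is_PID :: fm where
  "every_DH_domain_is_PID =
    (\<^bold>\<forall>\<^sub>S\<R>. \<^bold>\<forall>\<^sub>S\<A>. \<^bold>\<forall>\<^sub>S\<N>. \<^bold>\<forall>\<^sub>S\<M>. \<^bold>\<forall>\<z>. \<^bold>\<forall>\<e>. (is_DH_domain \<^bold>\<longrightarrow> is_Sigma01_PID))"

end

theory Submission
  imports Defs "HOL-Library.Countable_Set"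
begin

text \<open>
  By completeness of the calculus it suffices to argue in an arbitrary model. There, a nonzero
  \<open>\<Sigma>\<^sup>0\<^sub>1\<close>-ideal contains a nonzero \<open>c\<close> of least norm, because the values of the norm on the nonzero
  members of the ideal form a \<open>\<Sigma>\<^sup>0\<^sub>1\<close> class of numbers and \<open>\<Sigma>\<^sup>0\<^sub>1\<close> induction yields its least element. If
  \<open>c\<close> did not divide some member \<open>x\<close>, the Dedekind--Hasse property would provide a linear combination
  of \<open>x\<close> and \<open>c\<close>, hence a member of the ideal, whose norm is positive and smaller than that of \<open>c\<close>.
  Induction is also needed for the arithmetic that makes the pairing function injective.
\<close>

section \<open>Substitution and derivability\<close>

text \<open>Deriving the algebra inside the calculus would mean manipulating syntax at every step;
  models replace this by ordinary reasoning, at the price of a Henkin construction. The language has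
  no spare constants, so variables must serve as witnesses. They never run out, because
  \<open>RCA0\<close> consists of sentences and each stage uses up only finitely many. Inside a
  model, the obstacle is the restriction on induction. The norms of nonzero members need not form a
  set of the model, and describing them takes existential quantifiers over norm, index and member,
  whereas \<open>Sigma01\<close> permits a single one in front of a bounded matrix; a common bound
  merges the three. Zero has to be kept out of the minimisation, since its norm would always win;
  hence the zero ideal is a case of its own. Ring operations are sets of coded pairs, so every
  algebraic identity is argued through totality and single-valuedness of graphs.\<close>

lemma substt_substt: "substt \<sigma> (substt \<tau> t) = substt (\<lambda>i. substt \<sigma> (\<tau> i)) t"
  by (induction t) auto

lemma subst_subst:
  "subst \<sigma> \<rho> (subst \<tau> \<pi> \<phi>) = subst (\<lambda>i. substt \<sigma> (\<tau> i)) (\<lambda>i. \<rho> (\<pi> i)) \<phi>"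
proof (induction \<phi> arbitrary: \<sigma> \<tau> \<rho> \<pi>)
  case (All \<phi>)
  have "(\<lambda>i. substt (case_nat (Var 0) (\<lambda>i. shiftt (\<sigma> i))) (case_nat (Var 0) (\<lambda>i. shiftt (\<tau> i)) i))
      = case_nat (Var 0) (\<lambda>i. shiftt (substt \<sigma> (\<tau> i)))"
    by (auto simp: fun_eq_iff substt_substt split: nat.split)
  then show ?case by (simp add: All)
next
  case (AllS \<phi>)
  have "(\<lambda>i. case_nat 0 (\<lambda>i. Suc (\<rho> i)) (case_nat 0 (\<lambda>i. Suc (\<pi> i)) i))
      = case_nat 0 (\<lambda>i. Suc (\<rho> (\<pi> i)))"
    by (auto simp: fun_eq_iff split: nat.split)
  then show ?case by (simp add: AllS)
qed (auto simp: substt_substt)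

lemma substt_cong: "(\<And>i. i \<in> fvt t \<Longrightarrow> \<sigma> i = \<sigma>' i) \<Longrightarrow> substt \<sigma> t = substt \<sigma>' t"
  by (induction t) auto

lemma subst_cong:
  assumes "\<And>i. i \<in> fv \<phi> \<Longrightarrow> \<sigma> i = \<sigma>' i" "\<And>i. i \<in> fvS \<phi> \<Longrightarrow> \<rho> i = \<rho>' i"
  shows "subst \<sigma> \<rho> \<phi> = subst \<sigma>' \<rho>' \<phi>"
  using assms
proof (induction \<phi> arbitrary: \<sigma> \<sigma>' \<rho> \<rho>')
  case (All \<phi>)
  show ?case
    unfolding subst.simps fm.inject by (rule All.IH) (auto simp: All.prems split: nat.split)
next
  case (AllS \<phi>)
  show ?case
    unfolding subst.simps fm.inject by (rule AllS.IH) (auto simp: AllS.prems split: nat.split)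
next
  case (Imp \<phi> \<psi>)
  show ?case
    unfolding subst.simps fm.inject by (intro conjI Imp.IH) (auto simp: Imp.prems)
next
  case (Eq s t) then show ?case using substt_cong[of s \<sigma> \<sigma>'] substt_cong[of t \<sigma> \<sigma>'] by simp
next
  case (Lt s t) then show ?case using substt_cong[of s \<sigma> \<sigma>'] substt_cong[of t \<sigma> \<sigma>'] by simp
next
  case (Mem t X) then show ?case using substt_cong[of t \<sigma> \<sigma>'] by simp
qed auto

lemma substt_Var [simp]: "substt Var t = t"
  by (induction t) auto

lemma subst_Var [simp]: "subst Var (\<lambda>i. i) \<phi> = \<phi>"
proof (induction \<phi>)
  case (All \<phi>)
  have "case_nat (Var 0) (\<lambda>i. shiftt (Var i)) = Var"
    by (auto simp: fun_eq_iff split: nat.split)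
  then show ?case using All by simp
next
  case (AllS \<phi>)
  have "case_nat 0 (\<lambda>i. Suc i) = (\<lambda>i. i)"
    by (auto simp: fun_eq_iff split: nat.split)
  then show ?case using AllS by simp
qed auto

text \<open>Instantiating after a lifted substitution just extends that substitution by one entry.
  This is the form in which the quantifier and equality rules meet substitution, both in
  \<open>derives_subst\<close> and in the truth lemma of the term model.\<close>

lemma inst_subst_lift:
  "inst t (subst (case_nat (Var 0) (\<lambda>i. shiftt (\<sigma> i))) \<rho> \<phi>) = subst (case_nat t \<sigma>) \<rho> \<phi>"
proof -
  have "(\<lambda>i. substt (case_nat t Var) (case_nat (Var 0) (\<lambda>i. shiftt (\<sigma> i)) i)) = case_nat t \<sigma>"
    by (auto simp: fun_eq_iff substt_substt split: nat.split)
  then show ?thesis by (simp add: subst_subst)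
qed

lemma instS_subst_lift:
  "instS X (subst \<sigma> (case_nat 0 (\<lambda>i. Suc (\<rho> i))) \<phi>) = subst \<sigma> (case_nat X \<rho>) \<phi>"
proof -
  have "(\<lambda>i. case_nat X (\<lambda>i. i) (case_nat 0 (\<lambda>i. Suc (\<rho> i)) i)) = case_nat X \<rho>"
    by (auto simp: fun_eq_iff split: nat.split)
  then show ?thesis by (simp add: subst_subst)
qed

lemma subst_inst: "subst \<sigma> \<rho> (inst t \<phi>) = subst (case_nat (substt \<sigma> t) \<sigma>) \<rho> \<phi>"
proof -
  have "(\<lambda>i. substt \<sigma> (case_nat t Var i)) = case_nat (substt \<sigma> t) \<sigma>"
    by (auto simp: fun_eq_iff split: nat.split)
  then show ?thesis by (simp add: subst_subst)
qed

lemma subst_instS: "subst \<sigma> \<rho> (instS X \<phi>) = subst \<sigma> (case_nat (\<rho> X) \<rho>) \<phi>"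
proof -
  have "(\<lambda>i. \<rho> (case_nat X (\<lambda>i. i) i)) = case_nat (\<rho> X) \<rho>"
    by (auto simp: fun_eq_iff split: nat.split)
  then show ?thesis by (simp add: subst_subst)
qed

lemma derives_mono: "\<Gamma> \<turnstile> \<phi> \<Longrightarrow> \<Gamma> \<subseteq> \<Delta> \<Longrightarrow> \<Delta> \<turnstile> \<phi>"
proof (induction arbitrary: \<Delta> rule: derives.induct)
  case (ImpI \<phi> \<Gamma> \<psi>) then show ?case by (meson derives.ImpI insert_mono)
next
  case (Raa \<phi> \<Gamma>) then show ?case by (meson derives.Raa insert_mono)
next
  case (AllI \<Gamma> \<phi>) show ?case by (intro derives.AllI AllI.IH image_mono AllI.prems)
next
  case (AllSI \<Gamma> \<phi>) show ?case by (intro derives.AllSI AllSI.IH image_mono AllSI.prems)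
next
  case (EqE \<Gamma> s t \<phi>) show ?case
    by (rule derives.EqE[OF EqE.IH(1)[OF EqE.prems] EqE.IH(2)[OF EqE.prems]])
next
  case (ImpE \<Gamma> \<phi> \<psi>) show ?case
    by (rule derives.ImpE[OF ImpE.IH(1)[OF ImpE.prems] ImpE.IH(2)[OF ImpE.prems]])
next
  case (AllE \<Gamma> \<phi> t) show ?case by (rule derives.AllE[OF AllE.IH[OF AllE.prems]])
next
  case (AllSE \<Gamma> \<phi> X) show ?case by (rule derives.AllSE[OF AllSE.IH[OF AllSE.prems]])
qed (auto intro: derives.Assm derives.EqI)

text \<open>A lifted substitution commutes with \<open>shift\<close>, so the shifted hypotheses of
  the generalisation rules keep their form. The result serves to rename eigenvariables.\<close>

lemma derives_subst: "\<Gamma> \<turnstile> \<phi> \<Longrightarrow> subst \<sigma> \<rho> ` \<Gamma> \<turnstile> subst \<sigma> \<rho> \<phi>"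
proof (induction arbitrary: \<sigma> \<rho> rule: derives.induct)
  case (AllI \<Gamma> \<phi>)
  have "subst (case_nat (Var 0) (\<lambda>i. shiftt (\<sigma> i))) \<rho> ` shift ` \<Gamma> = shift ` subst \<sigma> \<rho> ` \<Gamma>"
    by (simp add: image_image subst_subst)
  then show ?case
    using AllI.IH[of "case_nat (Var 0) (\<lambda>i. shiftt (\<sigma> i))" \<rho>] derives.AllI by simp
next
  case (AllSI \<Gamma> \<phi>)
  have "subst \<sigma> (case_nat 0 (\<lambda>i. Suc (\<rho> i))) ` shiftS ` \<Gamma> = shiftS ` subst \<sigma> \<rho> ` \<Gamma>"
    by (simp add: image_image subst_subst)
  then show ?case
    using AllSI.IH[of \<sigma> "case_nat 0 (\<lambda>i. Suc (\<rho> i))"] derives.AllSI by simp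
next
  case (AllE \<Gamma> \<phi> t)
  show ?case using derives.AllE[OF AllE.IH[unfolded subst.simps], of \<sigma> \<rho> "substt \<sigma> t"]
    by (simp only: inst_subst_lift subst_inst)
next
  case (AllSE \<Gamma> \<phi> X)
  show ?case using derives.AllSE[OF AllSE.IH[unfolded subst.simps], of \<sigma> \<rho> "\<rho> X"]
    by (simp only: instS_subst_lift subst_instS)
next
  case (EqE \<Gamma> s t \<phi>)
  show ?case
    using derives.EqE[OF EqE.IH(1)[unfolded subst.simps],
        of \<sigma> \<rho> "subst (case_nat (Var 0) (\<lambda>i. shiftt (\<sigma> i))) \<rho> \<phi>"] EqE.IH(2)[of \<sigma> \<rho>]
    by (simp only: inst_subst_lift subst_inst)
next
  case (ImpE \<Gamma> \<phi> \<psi>)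
  show ?case using ImpE.IH[of \<sigma> \<rho>] by (auto intro: derives.ImpE)
next
  case (Raa \<phi> \<Gamma>)
  show ?case using Raa.IH[of \<sigma> \<rho>] by (intro derives.Raa[of "subst \<sigma> \<rho> \<phi>"]) simp
qed (auto intro: derives.Assm derives.ImpI derives.EqI)

text \<open>Compactness, which makes the union of a chain of consistent sets consistent. In the
  generalisation cases a finite part of the shifted hypotheses is the shift of a finite
  part.\<close>

lemma derives_finite: "\<Gamma> \<turnstile> \<phi> \<Longrightarrow> \<exists>\<Delta> \<subseteq> \<Gamma>. finite \<Delta> \<and> \<Delta> \<turnstile> \<phi>"
proof (induction rule: derives.induct)
  case (Assm \<phi> \<Gamma>)
  then show ?case by (intro exI[of _ "{\<phi>}"]) (auto intro: derives.Assm)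
next
  case (ImpI \<phi> \<Gamma> \<psi>)
  then obtain \<Delta> where \<Delta>: "\<Delta> \<subseteq> insert \<phi> \<Gamma>" "finite \<Delta>" "\<Delta> \<turnstile> \<psi>" by blast
  have "insert \<phi> (\<Delta> - {\<phi>}) \<turnstile> \<psi>" by (rule derives_mono[OF \<Delta>(3)]) auto
  with \<Delta>(1,2) show ?case
    by (intro exI[of _ "\<Delta> - {\<phi>}"]) (auto intro: derives.ImpI)
next
  case (Raa \<phi> \<Gamma>)
  then obtain \<Delta> where \<Delta>: "\<Delta> \<subseteq> insert (\<^bold>\<not> \<phi>) \<Gamma>" "finite \<Delta>" "\<Delta> \<turnstile> \<^bold>\<bottom>" by blast
  have "insert (\<^bold>\<not> \<phi>) (\<Delta> - {\<^bold>\<not> \<phi>}) \<turnstile> \<^bold>\<bottom>" by (rule derives_mono[OF \<Delta>(3)]) auto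
  with \<Delta>(1,2) show ?case
    by (intro exI[of _ "\<Delta> - {\<^bold>\<not> \<phi>}"]) (auto intro: derives.Raa)
next
  case (ImpE \<Gamma> \<phi> \<psi>)
  then obtain \<Delta> \<Delta>' where "\<Delta> \<subseteq> \<Gamma>" "finite \<Delta>" "\<Delta> \<turnstile> \<phi> \<^bold>\<longrightarrow> \<psi>"
    and "\<Delta>' \<subseteq> \<Gamma>" "finite \<Delta>'" "\<Delta>' \<turnstile> \<phi>" by blast
  then show ?case
    by (intro exI[of _ "\<Delta> \<union> \<Delta>'"]) (auto intro: derives.ImpE derives_mono)
next
  case (AllI \<Gamma> \<phi>)
  then show ?case by (metis derives.AllI finite_subset_image)
next
  case (AllSI \<Gamma> \<phi>)
  then show ?case by (metis derives.AllSI finite_subset_image)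
next
  case (EqE \<Gamma> s t \<phi>)
  then obtain \<Delta> \<Delta>' where "\<Delta> \<subseteq> \<Gamma>" "finite \<Delta>" "\<Delta> \<turnstile> s \<^bold>= t"
    and "\<Delta>' \<subseteq> \<Gamma>" "finite \<Delta>'" "\<Delta>' \<turnstile> inst s \<phi>" by blast
  then show ?case
    by (intro exI[of _ "\<Delta> \<union> \<Delta>'"]) (auto intro: derives.EqE derives_mono)
next
  case (AllE \<Gamma> \<phi> t) then show ?case by (metis derives.AllE)
next
  case (AllSE \<Gamma> \<phi> X) then show ?case by (metis derives.AllSE)
next
  case (EqI \<Gamma> t) show ?case by (metis derives.EqI empty_subsetI finite.emptyI)
qed

text \<open>The usual eigenvariable rule, recovered from the rule with shifted hypotheses: the
  renaming that sends \<open>x\<close> to 0 and every other index up by one acts as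
  \<open>shift\<close> on formulas without \<open>x\<close> and turns the instance at
  \<open>x\<close> back into \<open>\<phi>\<close>.\<close>

lemma derives_All_fresh:
  assumes "\<Gamma> \<turnstile> inst (Var x) \<phi>" "x \<notin> fv (All \<phi>)" "\<And>\<gamma>. \<gamma> \<in> \<Gamma> \<Longrightarrow> x \<notin> fv \<gamma>"
  shows "\<Gamma> \<turnstile> All \<phi>"
proof (rule derives.AllI)
  define \<sigma> where "\<sigma> i = Var (if i = x then 0 else Suc i)" for i
  have "subst \<sigma> (\<lambda>i. i) ` \<Gamma> = shift ` \<Gamma>"
    by (intro image_cong refl subst_cong) (use assms(3) in \<open>auto simp: \<sigma>_def\<close>)
  moreover have "subst \<sigma> (\<lambda>i. i) (inst (Var x) \<phi>) = subst Var (\<lambda>i. i) \<phi>"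
    unfolding subst_inst
    by (intro subst_cong) (use assms(2) in \<open>auto simp: \<sigma>_def split: nat.split\<close>)
  ultimately show "shift ` \<Gamma> \<turnstile> \<phi>"
    using derives_subst[OF assms(1), of \<sigma> "\<lambda>i. i"] by simp
qed

lemma derives_AllS_fresh:
  assumes "\<Gamma> \<turnstile> instS X \<phi>" "X \<notin> fvS (AllS \<phi>)" "\<And>\<gamma>. \<gamma> \<in> \<Gamma> \<Longrightarrow> X \<notin> fvS \<gamma>"
  shows "\<Gamma> \<turnstile> AllS \<phi>"
proof (rule derives.AllSI)
  define \<rho> where "\<rho> i = (if i = X then 0 else Suc i)" for i
  have "subst Var \<rho> ` \<Gamma> = shiftS ` \<Gamma>"
    by (intro image_cong refl subst_cong) (use assms(3) in \<open>auto simp: \<rho>_def\<close>)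
  moreover have "subst Var \<rho> (instS X \<phi>) = subst Var (\<lambda>i. i) \<phi>"
    unfolding subst_instS
    by (intro subst_cong) (use assms(2) in \<open>auto simp: \<rho>_def split: nat.split\<close>)
  ultimately show "shiftS ` \<Gamma> \<turnstile> \<phi>"
    using derives_subst[OF assms(1), of Var \<rho>] by simp
qed

lemma finite_fvt [simp]: "finite (fvt t)"
  by (induction t) auto

lemma finite_fv [simp]: "finite (fv \<phi>)"
proof (induction \<phi>)
  case (All \<phi>)
  then show ?case using finite_vimageI[of "fv \<phi>" Suc] by (simp add: vimage_def)
qed auto

lemma finite_fvS [simp]: "finite (fvS \<phi>)"
proof (induction \<phi>)
  case (AllS \<phi>)
  then show ?case using finite_vimageI[of "fvS \<phi>" Suc] by (simp add: vimage_def)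
qed auto

lemma fv_All_funpow: "fv ((All ^^ k) \<phi>) = {i. i + k \<in> fv \<phi>}"
  by (induction k) auto

lemma fvS_All_funpow: "fvS ((All ^^ k) \<phi>) = fvS \<phi>"
  by (induction k) auto

lemma fv_AllS_funpow: "fv ((AllS ^^ k) \<phi>) = fv \<phi>"
  by (induction k) auto

lemma fvS_AllS_funpow: "fvS ((AllS ^^ k) \<phi>) = {i. i + k \<in> fvS \<phi>}"
  by (induction k) auto

section \<open>Structures\<close>

text \<open>Sets are an abstract sort with a membership relation rather than subsets of
  \<open>'n\<close>. No formula can compare sets for equality, so the Henkin model may use the
  indices of set variables as its sets.\<close>

locale L2_structure =
  fixes zero one :: 'n and add mul :: "'n \<Rightarrow> 'n \<Rightarrow> 'n" and lt :: "'n \<Rightarrow> 'n \<Rightarrow> bool"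
    and mem :: "'n \<Rightarrow> 's \<Rightarrow> bool"
begin

primrec evalt :: "(nat \<Rightarrow> 'n) \<Rightarrow> tm \<Rightarrow> 'n" where
  "evalt e (Var i) = e i"
| "evalt e Zero = zero"
| "evalt e One = one"
| "evalt e (Add s t) = add (evalt e s) (evalt e t)"
| "evalt e (Mul s t) = mul (evalt e s) (evalt e t)"

primrec sat :: "(nat \<Rightarrow> 'n) \<Rightarrow> (nat \<Rightarrow> 's) \<Rightarrow> fm \<Rightarrow> bool" where
  "sat e E (s \<^bold>= t) \<longleftrightarrow> evalt e s = evalt e t"
| "sat e E (s \<^bold>< t) \<longleftrightarrow> lt (evalt e s) (evalt e t)"
| "sat e E (t \<^bold>\<in> X) \<longleftrightarrow> mem (evalt e t) (E X)"
| "sat e E \<^bold>\<bottom> \<longleftrightarrow> False"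
| "sat e E (\<phi> \<^bold>\<longrightarrow> \<psi>) \<longleftrightarrow> (sat e E \<phi> \<longrightarrow> sat e E \<psi>)"
| "sat e E (All \<phi>) \<longleftrightarrow> (\<forall>v. sat (case_nat v e) E \<phi>)"
| "sat e E (AllS \<phi>) \<longleftrightarrow> (\<forall>V. sat e (case_nat V E) \<phi>)"

lemma evalt_substt: "evalt e (substt \<sigma> t) = evalt (\<lambda>i. evalt e (\<sigma> i)) t"
  by (induction t) auto

lemma sat_subst: "sat e E (subst \<sigma> \<rho> \<phi>) \<longleftrightarrow> sat (\<lambda>i. evalt e (\<sigma> i)) (\<lambda>i. E (\<rho> i)) \<phi>"
proof (induction \<phi> arbitrary: e E \<sigma> \<rho>)
  case (All \<phi>)
  have "(\<lambda>i. evalt (case_nat v e) (case_nat (Var 0) (\<lambda>i. shiftt (\<sigma> i)) i))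
      = case_nat v (\<lambda>i. evalt e (\<sigma> i))" for v
    by (auto simp: fun_eq_iff evalt_substt split: nat.split)
  then show ?case by (simp add: All)
next
  case (AllS \<phi>)
  have "(\<lambda>i. case_nat V E (case_nat 0 (\<lambda>i. Suc (\<rho> i)) i)) = case_nat V (\<lambda>i. E (\<rho> i))" for V
    by (auto simp: fun_eq_iff split: nat.split)
  then show ?case by (simp add: AllS)
qed (auto simp: evalt_substt)

lemma evalt_cong: "(\<And>i. i \<in> fvt t \<Longrightarrow> e i = e' i) \<Longrightarrow> evalt e t = evalt e' t"
  by (induction t) auto

lemma sat_cong:
  assumes "\<And>i. i \<in> fv \<phi> \<Longrightarrow> e i = e' i" "\<And>i. i \<in> fvS \<phi> \<Longrightarrow> E i = E' i"
  shows "sat e E \<phi> \<longleftrightarrow> sat e' E' \<phi>"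
  using assms
proof (induction \<phi> arbitrary: e e' E E')
  case (All \<phi>)
  have "sat (case_nat v e) E \<phi> \<longleftrightarrow> sat (case_nat v e') E' \<phi>" for v
    by (rule All.IH) (auto simp: All.prems split: nat.split)
  then show ?case by simp
next
  case (AllS \<phi>)
  have "sat e (case_nat V E) \<phi> \<longleftrightarrow> sat e' (case_nat V E') \<phi>" for V
    by (rule AllS.IH) (auto simp: AllS.prems split: nat.split)
  then show ?case by simp
next
  case (Imp \<phi> \<psi>)
  have "sat e E \<phi> \<longleftrightarrow> sat e' E' \<phi>" "sat e E \<psi> \<longleftrightarrow> sat e' E' \<psi>"
    by (rule Imp.IH; auto simp: Imp.prems)+
  then show ?case by simp
next
  case (Eq s t) then show ?case using evalt_cong[of s e e'] evalt_cong[of t e e'] by simp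
next
  case (Lt s t) then show ?case using evalt_cong[of s e e'] evalt_cong[of t e e'] by simp
next
  case (Mem t X) then show ?case using evalt_cong[of t e e'] by simp
qed auto

text \<open>A named quantifier becomes a function update, which spares all later formulas the de
  Bruijn bookkeeping.\<close>

lemma sat_alln [simp]: "sat e E (\<^bold>\<forall>x. \<phi>) \<longleftrightarrow> (\<forall>v. sat (e(x := v)) E \<phi>)"
proof -
  have "(\<lambda>i. evalt (case_nat v e) (Var (if i = x then 0 else Suc i))) = e(x := v)" for v
    by auto
  then show ?thesis by (simp add: alln_def sat_subst del: evalt.simps)
qed

lemma sat_alls [simp]: "sat e E (\<^bold>\<forall>\<^sub>SX. \<phi>) \<longleftrightarrow> (\<forall>V. sat e (E(X := V)) \<phi>)"
proof -
  have "(\<lambda>i. case_nat V E (if i = X then 0 else Suc i)) = E(X := V)" for V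
    by auto
  then show ?thesis by (simp add: alls_def sat_subst)
qed

lemma sat_All_funpow: "(\<And>e. sat e E ((All ^^ k) \<phi>)) \<Longrightarrow> sat e E \<phi>"
proof (induction k arbitrary: e)
  case (Suc k)
  have "sat e E ((All ^^ k) \<phi>)" for e
  proof -
    have "sat (case_nat (e 0) (\<lambda>i. e (Suc i))) E ((All ^^ k) \<phi>)"
      using Suc.prems by simp
    moreover have "case_nat (e 0) (\<lambda>i. e (Suc i)) = e"
      by (auto simp: fun_eq_iff split: nat.split)
    ultimately show ?thesis by simp
  qed
  then show ?case by (rule Suc.IH)
qed simp

lemma sat_AllS_funpow: "(\<And>E. sat e E ((AllS ^^ k) \<phi>)) \<Longrightarrow> sat e E \<phi>"
proof (induction k arbitrary: E)
  case (Suc k)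
  have "sat e E ((AllS ^^ k) \<phi>)" for E
  proof -
    have "sat e (case_nat (E 0) (\<lambda>i. E (Suc i))) ((AllS ^^ k) \<phi>)"
      using Suc.prems by simp
    moreover have "case_nat (E 0) (\<lambda>i. E (Suc i)) = E"
      by (auto simp: fun_eq_iff split: nat.split)
    ultimately show ?thesis by simp
  qed
  then show ?case by (rule Suc.IH)
qed simp

text \<open>Axiom schemes enter \<open>RCA0\<close> only as closed formulas. The truth of a sentence
  does not depend on the environment, so truth at \<open>e0\<close>, \<open>E0\<close> passes to all
  environments, and the prefix can then be peeled off.\<close>

lemma sat_if_closures:
  assumes "\<And>\<chi>. \<chi> \<in> closures \<phi> \<Longrightarrow> sat e0 E0 \<chi>"
  shows "sat e E \<phi>"
proof -
  \<comment> \<open>Prefixes longer than every free index bind all free variables.\<close>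
  obtain k l where k: "\<forall>i \<in> fv \<phi>. i < k" and l: "\<forall>i \<in> fvS \<phi>. i < l"
    using finite_nat_set_iff_bounded finite_fv finite_fvS by metis
  define \<chi> where "\<chi> = (AllS ^^ l) ((All ^^ k) \<phi>)"
  have sent: "sentence \<chi>"
    using k l unfolding sentence_def \<chi>_def
    by (fastforce simp: fv_AllS_funpow fv_All_funpow fvS_AllS_funpow fvS_All_funpow)
  then have "sat e0 E0 \<chi>"
    unfolding \<chi>_def by (intro assms) (auto simp: closures_def)
  then have "sat e E \<chi>" for e E
    using sat_cong[of \<chi> e0 e E0 E] sent by (simp add: sentence_def)
  then have "sat e E ((All ^^ k) \<phi>)" for e
    unfolding \<chi>_def by (rule sat_AllS_funpow)
  then show ?thesis by (rule sat_All_funpow)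
qed

end

section \<open>The Henkin construction\<close>

instance tm :: countable by countable_datatype
instance fm :: countable by countable_datatype

text \<open>Enough for fresh variables to exist at every stage of the construction.\<close>

definition almost_closed :: "fm set \<Rightarrow> bool" where
  "almost_closed \<Gamma> \<longleftrightarrow> finite (\<Union>(fv ` \<Gamma>)) \<and> finite (\<Union>(fvS ` \<Gamma>))"

lemma almost_closed_insert [simp]: "almost_closed (insert \<phi> \<Gamma>) \<longleftrightarrow> almost_closed \<Gamma>"
  by (auto simp: almost_closed_def)

text \<open>If every variable were refuted as a counterexample, so would be a fresh one, and
  generalising over it would derive \<open>All \<psi>\<close>. Freshness for \<open>\<Gamma>\<close>
  covers \<open>\<psi>\<close> as well, because the negated universal formula belongs to
  \<open>\<Gamma>\<close>.\<close>

lemma consistent_witness: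
  assumes "\<not> \<Gamma> \<turnstile> \<^bold>\<bottom>" "almost_closed \<Gamma>" "\<^bold>\<not> All \<psi> \<in> \<Gamma>"
  shows "\<exists>x. \<not> insert (\<^bold>\<not> inst (Var x) \<psi>) \<Gamma> \<turnstile> \<^bold>\<bottom>"
proof (rule ccontr)
  assume *: "\<nexists>x. \<not> insert (\<^bold>\<not> inst (Var x) \<psi>) \<Gamma> \<turnstile> \<^bold>\<bottom>"
  obtain x where x: "x \<notin> \<Union>(fv ` \<Gamma>)"
    using assms(2) ex_new_if_finite[OF infinite_UNIV_nat] unfolding almost_closed_def by blast
  have "\<Gamma> \<turnstile> All \<psi>"
    using x assms(3) * derives.Raa[of "inst (Var x) \<psi>" \<Gamma>] derives_All_fresh[of \<Gamma> x \<psi>] by force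
  then show False
    using assms(1,3) derives.Assm derives.ImpE by blast
qed

lemma consistent_witnessS:
  assumes "\<not> \<Gamma> \<turnstile> \<^bold>\<bottom>" "almost_closed \<Gamma>" "\<^bold>\<not> AllS \<psi> \<in> \<Gamma>"
  shows "\<exists>X. \<not> insert (\<^bold>\<not> instS X \<psi>) \<Gamma> \<turnstile> \<^bold>\<bottom>"
proof (rule ccontr)
  assume *: "\<nexists>X. \<not> insert (\<^bold>\<not> instS X \<psi>) \<Gamma> \<turnstile> \<^bold>\<bottom>"
  obtain X where X: "X \<notin> \<Union>(fvS ` \<Gamma>)"
    using assms(2) ex_new_if_finite[OF infinite_UNIV_nat] unfolding almost_closed_def by blast
  have "\<Gamma> \<turnstile> AllS \<psi>"
    using X assms(3) * derives.Raa[of "instS X \<psi>" \<Gamma>] derives_AllS_fresh[of \<Gamma> X \<psi>] by force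
  then show False
    using assms(1,3) derives.Assm derives.ImpE by blast
qed

text \<open>Maximality and the Henkin property merged into a condition on a single formula. It
  survives enlargement of \<open>\<Gamma>\<close>, so one pass through an enumeration of all
  formulas secures it for each of them.\<close>

definition decides :: "fm set \<Rightarrow> fm \<Rightarrow> bool" where
  "decides \<Gamma> \<phi> \<longleftrightarrow> \<Gamma> \<turnstile> \<^bold>\<not> \<phi> \<or>
    (\<phi> \<in> \<Gamma> \<and>
     (\<forall>\<psi>. \<phi> = \<^bold>\<not> All \<psi> \<longrightarrow> (\<exists>x. \<^bold>\<not> inst (Var x) \<psi> \<in> \<Gamma>)) \<and>
     (\<forall>\<psi>. \<phi> = \<^bold>\<not> AllS \<psi> \<longrightarrow> (\<exists>X. \<^bold>\<not> instS X \<psi> \<in> \<Gamma>)))"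

lemma decides_mono: "decides \<Gamma> \<phi> \<Longrightarrow> \<Gamma> \<subseteq> \<Delta> \<Longrightarrow> decides \<Delta> \<phi>"
  unfolding decides_def using derives_mono[of \<Gamma> "\<^bold>\<not> \<phi>" \<Delta>] by (elim disjE) blast+

lemma decides_extension:
  assumes "\<not> \<Gamma> \<turnstile> \<^bold>\<bottom>" "almost_closed \<Gamma>"
  shows "\<exists>\<Delta>. \<Gamma> \<subseteq> \<Delta> \<and> \<not> \<Delta> \<turnstile> \<^bold>\<bottom> \<and> almost_closed \<Delta> \<and> decides \<Delta> \<phi>"
proof (cases "insert \<phi> \<Gamma> \<turnstile> \<^bold>\<bottom>")
  case True
  then show ?thesis
    using assms by (intro exI[of _ \<Gamma>]) (auto simp: decides_def intro: derives.ImpI)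
next
  case False
  consider \<psi> where "\<phi> = \<^bold>\<not> All \<psi>" | \<psi> where "\<phi> = \<^bold>\<not> AllS \<psi>"
    | "\<nexists>\<psi>. \<phi> = \<^bold>\<not> All \<psi> \<or> \<phi> = \<^bold>\<not> AllS \<psi>" by blast
  then show ?thesis
  proof cases
    case 1
    then obtain x where "\<not> insert (\<^bold>\<not> inst (Var x) \<psi>) (insert \<phi> \<Gamma>) \<turnstile> \<^bold>\<bottom>"
      using consistent_witness[of "insert \<phi> \<Gamma>" \<psi>] False assms by auto
    with 1 assms show ?thesis
      by (intro exI[of _ "insert (\<^bold>\<not> inst (Var x) \<psi>) (insert \<phi> \<Gamma>)"]) (auto simp: decides_def)
  next
    case 2
    then obtain X where "\<not> insert (\<^bold>\<not> instS X \<psi>) (insert \<phi> \<Gamma>) \<turnstile> \<^bold>\<bottom>"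
      using consistent_witnessS[of "insert \<phi> \<Gamma>" \<psi>] False assms by auto
    with 2 assms show ?thesis
      by (intro exI[of _ "insert (\<^bold>\<not> instS X \<psi>) (insert \<phi> \<Gamma>)"]) (auto simp: decides_def)
  next
    case 3
    with False assms show ?thesis
      by (intro exI[of _ "insert \<phi> \<Gamma>"]) (auto simp: decides_def)
  qed
qed

text \<open>Stage \<open>n\<close> settles the formula with code \<open>n\<close>. The union stays
  consistent because a derivation of falsity uses finitely many hypotheses, which already lie in one
  stage.\<close>

lemma henkin_extension:
  assumes "\<not> \<Gamma> \<turnstile> \<^bold>\<bottom>" "almost_closed \<Gamma>"
  shows "\<exists>S. \<Gamma> \<subseteq> S \<and> \<not> S \<turnstile> \<^bold>\<bottom> \<and> (\<forall>\<phi>. decides S \<phi>)"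
proof -
  define P where "P n \<Delta> \<longleftrightarrow> \<Gamma> \<subseteq> \<Delta> \<and> \<not> \<Delta> \<turnstile> \<^bold>\<bottom> \<and> almost_closed \<Delta>" for n :: nat and \<Delta>
  define Q where "Q n \<Delta> \<Delta>' \<longleftrightarrow> \<Delta> \<subseteq> \<Delta>' \<and> decides \<Delta>' (from_nat n)" for n and \<Delta> \<Delta>' :: "fm set"
  have "\<exists>\<Delta>'. P (Suc n) \<Delta>' \<and> Q n \<Delta> \<Delta>'" if "P n \<Delta>" for n \<Delta>
    using decides_extension[of \<Delta> "from_nat n"] that unfolding P_def Q_def by blast
  moreover have "\<exists>\<Delta>. P 0 \<Delta>" using assms unfolding P_def by blast
  ultimately obtain T where P: "\<And>n. P n (T n)" and Q: "\<And>n. Q n (T n) (T (Suc n))"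
    using dependent_nat_choice[of P Q] by blast
  have mono: "T m \<subseteq> T n" if "m \<le> n" for m n
    using that Q lift_Suc_mono_le[of T] unfolding Q_def by blast
  have "\<not> (\<Union>n. T n) \<turnstile> \<^bold>\<bottom>"
  proof
    assume "(\<Union>n. T n) \<turnstile> \<^bold>\<bottom>"
    then obtain \<Delta> where "\<Delta> \<subseteq> (\<Union>n. T n)" "finite \<Delta>" "\<Delta> \<turnstile> \<^bold>\<bottom>"
      using derives_finite by blast
    moreover from this(2,1) have "\<exists>n. \<Delta> \<subseteq> T n"
    proof (induction \<Delta> rule: finite_induct)
      case empty show ?case by simp
    next
      case (insert \<gamma> F)
      then obtain m n where "\<gamma> \<in> T m" "F \<subseteq> T n" by blast
      then have "insert \<gamma> F \<subseteq> T (max m n)"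
        using mono[of m "max m n"] mono[of n "max m n"] by auto
      then show ?case by blast
    qed
    ultimately show False
      using P derives_mono unfolding P_def by blast
  qed
  moreover have "decides (\<Union>n. T n) \<phi>" for \<phi>
    using Q[of "to_nat \<phi>"] decides_mono[of "T (Suc (to_nat \<phi>))" \<phi> "\<Union>n. T n"] unfolding Q_def by auto
  moreover have "\<Gamma> \<subseteq> (\<Union>n. T n)" using P unfolding P_def by blast
  ultimately show ?thesis by blast
qed

text \<open>Replacement is applied to the reflexive equation with its left side shifted: a shifted
  term is unaffected by \<open>inst\<close>, so only the right-hand copy of \<open>u\<close>
  changes.\<close>

lemma derives_Eq_cong:
  assumes "\<Gamma> \<turnstile> s \<^bold>= t"
  shows "\<Gamma> \<turnstile> substt (case_nat s Var) u \<^bold>= substt (case_nat t Var) u"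
proof -
  have "inst w (shiftt (substt (case_nat s Var) u) \<^bold>= u)
      = (substt (case_nat s Var) u \<^bold>= substt (case_nat w Var) u)" for w
    by (simp add: substt_substt)
  then show ?thesis
    using derives.EqE[OF assms, of "shiftt (substt (case_nat s Var) u) \<^bold>= u"] derives.EqI by metis
qed

lemma derives_Eq_sym: "\<Gamma> \<turnstile> s \<^bold>= t \<Longrightarrow> \<Gamma> \<turnstile> t \<^bold>= s"
  using derives.EqE[of \<Gamma> s t "Var 0 \<^bold>= shiftt s"] derives.EqI by (simp add: substt_substt)

lemma derives_Eq_trans: "\<Gamma> \<turnstile> s \<^bold>= t \<Longrightarrow> \<Gamma> \<turnstile> t \<^bold>= u \<Longrightarrow> \<Gamma> \<turnstile> s \<^bold>= u"
  using derives.EqE[of \<Gamma> t u "shiftt s \<^bold>= Var 0"] by (simp add: substt_substt)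

lemma derives_Eq_Add:
  assumes "\<Gamma> \<turnstile> s \<^bold>= s'" "\<Gamma> \<turnstile> t \<^bold>= t'"
  shows "\<Gamma> \<turnstile> Add s t \<^bold>= Add s' t'"
proof (rule derives_Eq_trans)
  show "\<Gamma> \<turnstile> Add s t \<^bold>= Add s' t"
    using derives_Eq_cong[OF assms(1), of "Add (Var 0) (shiftt t)"] by (simp add: substt_substt)
  show "\<Gamma> \<turnstile> Add s' t \<^bold>= Add s' t'"
    using derives_Eq_cong[OF assms(2), of "Add (shiftt s') (Var 0)"] by (simp add: substt_substt)
qed

lemma derives_Eq_Mul:
  assumes "\<Gamma> \<turnstile> s \<^bold>= s'" "\<Gamma> \<turnstile> t \<^bold>= t'"
  shows "\<Gamma> \<turnstile> Mul s t \<^bold>= Mul s' t'"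
proof (rule derives_Eq_trans)
  show "\<Gamma> \<turnstile> Mul s t \<^bold>= Mul s' t"
    using derives_Eq_cong[OF assms(1), of "Mul (Var 0) (shiftt t)"] by (simp add: substt_substt)
  show "\<Gamma> \<turnstile> Mul s' t \<^bold>= Mul s' t'"
    using derives_Eq_cong[OF assms(2), of "Mul (shiftt s') (Var 0)"] by (simp add: substt_substt)
qed

lemma derives_Lt_cong:
  assumes "\<Gamma> \<turnstile> s \<^bold>= s'" "\<Gamma> \<turnstile> t \<^bold>= t'" "\<Gamma> \<turnstile> s \<^bold>< t"
  shows "\<Gamma> \<turnstile> s' \<^bold>< t'"
  using derives.EqE[OF assms(1), of "Var 0 \<^bold>< shiftt t"]
    derives.EqE[OF assms(2), of "shiftt s' \<^bold>< Var 0"] assms(3)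
  by (simp add: substt_substt)

lemma derives_Mem_cong: "\<Gamma> \<turnstile> s \<^bold>= t \<Longrightarrow> \<Gamma> \<turnstile> s \<^bold>\<in> X \<Longrightarrow> \<Gamma> \<turnstile> t \<^bold>\<in> X"
  using derives.EqE[of \<Gamma> s t "Var 0 \<^bold>\<in> X"] by simp

section \<open>Derivability from a Henkin set behaves like truth\<close>

locale henkin =
  fixes S :: "fm set"
  assumes consistent: "\<not> S \<turnstile> \<^bold>\<bottom>" and decides: "decides S \<phi>"
begin

lemma derives_Imp_iff: "S \<turnstile> \<phi> \<^bold>\<longrightarrow> \<psi> \<longleftrightarrow> (S \<turnstile> \<phi> \<longrightarrow> S \<turnstile> \<psi>)"
proof -
  have "S \<turnstile> \<phi> \<^bold>\<longrightarrow> \<psi>" if "S \<turnstile> \<^bold>\<not> \<phi>"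
  proof -
    have "insert \<phi> S \<turnstile> \<^bold>\<bottom>"
      using derives_mono[OF that] by (blast intro: derives.Assm derives.ImpE)
    then have "insert (\<^bold>\<not> \<psi>) (insert \<phi> S) \<turnstile> \<^bold>\<bottom>" by (rule derives_mono) auto
    then show ?thesis by (rule derives.ImpI[OF derives.Raa])
  qed
  moreover have "S \<turnstile> \<phi> \<^bold>\<longrightarrow> \<psi>" if "S \<turnstile> \<psi>"
    using derives_mono[OF that] by (blast intro: derives.ImpI)
  moreover have "S \<turnstile> \<phi> \<or> S \<turnstile> \<^bold>\<not> \<phi>"
    using decides[of \<phi>] by (auto simp: decides_def intro: derives.Assm)
  ultimately show ?thesis by (blast intro: derives.ImpE)
qed

lemma derives_All_iff: "S \<turnstile> All \<phi> \<longleftrightarrow> (\<forall>t. S \<turnstile> inst t \<phi>)"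
proof
  assume *: "\<forall>t. S \<turnstile> inst t \<phi>"
  show "S \<turnstile> All \<phi>"
  proof (rule ccontr)
    assume "\<not> S \<turnstile> All \<phi>"
    \<comment> \<open>This excludes the first alternative of \<open>decides\<close> for the negated
      universal formula; the second one supplies a counterexample.\<close>
    then have "\<not> S \<turnstile> \<^bold>\<not> \<^bold>\<not> All \<phi>" using consistent by (simp add: derives_Imp_iff)
    then obtain x where "\<^bold>\<not> inst (Var x) \<phi> \<in> S"
      using decides[of "\<^bold>\<not> All \<phi>"] unfolding decides_def by blast
    then show False using * consistent derives.Assm derives.ImpE by blast
  qed
qed (blast intro: derives.AllE)

lemma derives_AllS_iff: "S \<turnstile> AllS \<phi> \<longleftrightarrow> (\<forall>X. S \<turnstile> instS X \<phi>)"
proof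
  assume *: "\<forall>X. S \<turnstile> instS X \<phi>"
  show "S \<turnstile> AllS \<phi>"
  proof (rule ccontr)
    assume "\<not> S \<turnstile> AllS \<phi>"
    then have "\<not> S \<turnstile> \<^bold>\<not> \<^bold>\<not> AllS \<phi>" using consistent by (simp add: derives_Imp_iff)
    then obtain X where "\<^bold>\<not> instS X \<phi> \<in> S"
      using decides[of "\<^bold>\<not> AllS \<phi>"] unfolding decides_def by blast
    then show False using * consistent derives.Assm derives.ImpE by blast
  qed
qed (blast intro: derives.AllSE)

text \<open>
  Infinitely many classes allow the Henkin model to be carried by the whole type \<open>nat\<close>, so that
  structures need no carrier sets.
\<close>

lemma infinitely_many_classes:
  assumes "basic_axioms \<subseteq> S"
  shows "infinite (UNIV // {(s, t). S \<turnstile> s \<^bold>= t})"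
proof -
  define num where "num n = ((\<lambda>t. Add t One) ^^ n) Zero" for n
  have "S \<turnstile> \<^bold>\<forall>\<n>. \<^bold>\<not> (Add (Var \<n>) One \<^bold>= Zero)"
    using assms by (intro derives.Assm) (auto simp: basic_axioms_def)
  then have pos: "\<not> S \<turnstile> Add t One \<^bold>= Zero" for t
    using consistent by (auto simp: alln_def derives_All_iff derives_Imp_iff)
  have "S \<turnstile> \<^bold>\<forall>\<m>. \<^bold>\<forall>\<n>. (Add (Var \<m>) One \<^bold>= Add (Var \<n>) One \<^bold>\<longrightarrow> Var \<m> \<^bold>= Var \<n>)"
    using assms by (intro derives.Assm) (auto simp: basic_axioms_def)
  then have inj: "S \<turnstile> s \<^bold>= t" if "S \<turnstile> Add s One \<^bold>= Add t One" for s t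
    using that by (simp add: alln_def derives_All_iff derives_Imp_iff subst_inst subst_subst substt_substt)
  have num_inj: "m = n" if "S \<turnstile> num m \<^bold>= num n" for m n
    using that
  proof (induction m arbitrary: n)
    case 0
    then show ?case using pos derives_Eq_sym by (cases n) (auto simp: num_def)
  next
    case (Suc m)
    then show ?case using pos inj by (cases n) (auto simp: num_def)
  qed
  have "inj (\<lambda>n. {(s, t). S \<turnstile> s \<^bold>= t} `` {num n})"
  proof (rule injI)
    fix m n assume "{(s, t). S \<turnstile> s \<^bold>= t} `` {num m} = {(s, t). S \<turnstile> s \<^bold>= t} `` {num n}"
    then show "m = n" using derives.EqI[of S "num n"] by (intro num_inj) blast
  qed
  moreover have "range (\<lambda>n. {(s, t). S \<turnstile> s \<^bold>= t} `` {num n}) \<subseteq> UNIV // {(s, t). S \<turnstile> s \<^bold>= t}"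
    by (intro image_subsetI quotientI UNIV_I)
  ultimately show ?thesis
    using range_inj_infinite finite_subset by blast
qed

lemma equiv_Eq: "equiv UNIV {(s, t). S \<turnstile> s \<^bold>= t}"
proof (rule equivI)
  show "sym {(s, t). S \<turnstile> s \<^bold>= t}"
    unfolding sym_def using derives_Eq_sym by blast
  show "trans {(s, t). S \<turnstile> s \<^bold>= t}"
    unfolding trans_def using derives_Eq_trans by blast
qed (auto simp: refl_on_def derives.EqI)

lemma quotient_map:
  assumes "basic_axioms \<subseteq> S"
  obtains cls :: "tm \<Rightarrow> nat" where "surj cls" "\<And>s t. cls s = cls t \<longleftrightarrow> S \<turnstile> s \<^bold>= t"
proof
  define r where "r = {(s, t). S \<turnstile> s \<^bold>= t}"
  define h where "h = to_nat_on (UNIV // r)"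
  have "countable (UNIV // r)"
    unfolding quotient_def by auto
  then have h: "bij_betw h (UNIV // r) UNIV"
    unfolding h_def r_def using infinitely_many_classes[OF assms] by (rule to_nat_on_infinite)
  show "surj (\<lambda>t. h (r `` {t}))"
    using h unfolding bij_betw_def quotient_def by (auto simp: image_def)
  show "h (r `` {s}) = h (r `` {t}) \<longleftrightarrow> S \<turnstile> s \<^bold>= t" for s t
    using inj_on_eq_iff[OF bij_betw_imp_inj_on[OF h], of "r `` {s}" "r `` {t}"]
      eq_equiv_class_iff[OF equiv_Eq, of s t] quotientI[of s UNIV r] quotientI[of t UNIV r]
    by (simp add: r_def)
qed

end

text \<open>The term model: numbers are classes of open terms modulo provable equality, numbered by
  \<open>nat\<close>, sets are indices of set variables, and each variable denotes itself. The basic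
  axioms make the classes infinite in number.\<close>

theorem model_existence:
  assumes "\<not> \<Gamma> \<turnstile> \<^bold>\<bottom>" "almost_closed \<Gamma>" "basic_axioms \<subseteq> \<Gamma>"
  shows "\<exists>zero one add mul lt (mem :: nat \<Rightarrow> nat \<Rightarrow> bool) e E.
    \<forall>\<gamma> \<in> \<Gamma>. L2_structure.sat zero one add mul lt mem e E \<gamma>"
proof -
  obtain S where S: "\<Gamma> \<subseteq> S" "\<not> S \<turnstile> \<^bold>\<bottom>" "\<And>\<phi>. decides S \<phi>"
    using henkin_extension[OF assms(1,2)] by blast
  interpret henkin S by (rule henkin.intro) (fact S)+
  obtain cls :: "tm \<Rightarrow> nat" where surj: "surj cls" and cls: "\<And>s t. cls s = cls t \<longleftrightarrow> S \<turnstile> s \<^bold>= t"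
    using quotient_map S(1) assms(3) by blast
  define rep where "rep = inv cls"
  have cls_rep [simp]: "cls (rep v) = v" for v
    unfolding rep_def using surj by (simp add: surj_f_inv_f)
  then have rep: "S \<turnstile> rep (cls t) \<^bold>= t" "S \<turnstile> t \<^bold>= rep (cls t)" for t
    by (simp_all flip: cls)
  interpret L2_structure "cls Zero" "cls One" "\<lambda>v w. cls (Add (rep v) (rep w))"
    "\<lambda>v w. cls (Mul (rep v) (rep w))" "\<lambda>v w. S \<turnstile> rep v \<^bold>< rep w" "\<lambda>v X. S \<turnstile> rep v \<^bold>\<in> X" .
  have evalt: "evalt (\<lambda>i. cls (\<sigma> i)) t = cls (substt \<sigma> t)" for \<sigma> t
    by (induction t) (auto simp: cls rep intro: derives_Eq_Add derives_Eq_Mul)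
  \<comment> \<open>The truth lemma has to range over all substitutions: below a quantifier the
    environment gains the class of a term and the substitution gains the term. Every number is such
    a class, namely that of its representative.\<close>
  have "sat (\<lambda>i. cls (\<sigma> i)) \<rho> \<phi> \<longleftrightarrow> S \<turnstile> subst \<sigma> \<rho> \<phi>" for \<sigma> \<rho> \<phi>
  proof (induction \<phi> arbitrary: \<sigma> \<rho>)
    case (Lt s t)
    show ?case using derives_Lt_cong rep by (simp add: evalt) blast
  next
    case (Mem t X)
    show ?case using derives_Mem_cong rep by (simp add: evalt) blast
  next
    case (All \<phi>)
    have "case_nat (cls t) (\<lambda>i. cls (\<sigma> i)) = (\<lambda>i. cls (case_nat t \<sigma> i))" for t
      by (auto simp: fun_eq_iff split: nat.split)
    then have "sat (case_nat (cls t) (\<lambda>i. cls (\<sigma> i))) \<rho> \<phi> \<longleftrightarrow> S \<turnstile> subst (case_nat t \<sigma>) \<rho> \<phi>" for t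
      by (simp add: All)
    then show ?case
      unfolding sat.simps subst.simps derives_All_iff inst_subst_lift by (metis cls_rep)
  next
    case (AllS \<phi>)
    then show ?case
      unfolding sat.simps subst.simps derives_AllS_iff instS_subst_lift by simp
  qed (auto simp: evalt cls derives_Imp_iff consistent)
  from this[of Var "\<lambda>i. i"] have "sat (\<lambda>i. cls (Var i)) (\<lambda>i. i) \<gamma>" if "\<gamma> \<in> \<Gamma>" for \<gamma>
    using that S(1) derives.Assm by auto
  then show ?thesis by blast
qed

text \<open>Structures on \<open>nat\<close> suffice because the language is countable.\<close>

corollary completeness:
  assumes "almost_closed \<Gamma>" "basic_axioms \<subseteq> \<Gamma>"
    and valid: "\<And>zero one add mul lt (mem :: nat \<Rightarrow> nat \<Rightarrow> bool) e E.
      (\<And>\<gamma>. \<gamma> \<in> \<Gamma> \<Longrightarrow> L2_structure.sat zero one add mul lt mem e E \<gamma>) \<Longrightarrow>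
      L2_structure.sat zero one add mul lt mem e E \<phi>"
  shows "\<Gamma> \<turnstile> \<phi>"
proof (rule ccontr)
  assume "\<not> \<Gamma> \<turnstile> \<phi>"
  then have "\<not> insert (\<^bold>\<not> \<phi>) \<Gamma> \<turnstile> \<^bold>\<bottom>" using derives.Raa[of \<phi> \<Gamma>] by blast
  then obtain zero one add mul lt and mem :: "nat \<Rightarrow> nat \<Rightarrow> bool" and e E
    where *: "\<forall>\<gamma> \<in> insert (\<^bold>\<not> \<phi>) \<Gamma>. L2_structure.sat zero one add mul lt mem e E \<gamma>"
    using model_existence[of "insert (\<^bold>\<not> \<phi>) \<Gamma>"] assms(1,2)
    unfolding almost_closed_insert by blast
  then have "L2_structure.sat zero one add mul lt mem e E \<phi>" by (intro valid) auto
  with * show False by (simp add: L2_structure.sat.simps)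
qed

section \<open>Arithmetic in a model\<close>

lemma almost_closed_RCA0: "almost_closed RCA0"
proof -
  have "sentence \<phi>" if "\<phi> \<in> basic_axioms" for \<phi>
    using that by (auto simp: basic_axioms_def sentence_def alln_def split: if_splits)
  then have "sentence \<phi>" if "\<phi> \<in> RCA0" for \<phi>
    using that by (auto simp: RCA0_def closures_def)
  then show ?thesis by (simp add: almost_closed_def sentence_def)
qed

locale RCA0_model = L2_structure zero one add mul lt mem
  for zero one :: 'n and add (infixl \<open>\<oplus>\<close> 65) and mul (infixl \<open>\<otimes>\<close> 70)
    and lt (infix \<open>\<prec>\<close> 50) and mem :: "'n \<Rightarrow> 's \<Rightarrow> bool" +
  fixes e0 :: "nat \<Rightarrow> 'n" and E0 :: "nat \<Rightarrow> 's"
  assumes sat_RCA0: "\<phi> \<in> RCA0 \<Longrightarrow> sat e0 E0 \<phi>"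
begin

lemma basic:
  "m \<oplus> one \<noteq> zero" "m \<oplus> one = n \<oplus> one \<longleftrightarrow> m = n"
  "m \<oplus> zero = m" "m \<oplus> (n \<oplus> one) = m \<oplus> n \<oplus> one"
  "m \<otimes> zero = zero" "m \<otimes> (n \<oplus> one) = m \<otimes> n \<oplus> m"
  "\<not> m \<prec> zero" "m \<prec> n \<oplus> one \<longleftrightarrow> m \<prec> n \<or> m = n"
proof -
  have *: "sat e0 E0 \<phi>" if "\<phi> \<in> basic_axioms" for \<phi>
    using that sat_RCA0 by (simp add: RCA0_def)
  show "m \<oplus> one \<noteq> zero"
    using *[of "\<^bold>\<forall>\<n>. \<^bold>\<not> (Add (Var \<n>) One \<^bold>= Zero)"] by (simp add: basic_axioms_def)
  have "m \<oplus> one = n \<oplus> one \<Longrightarrow> m = n"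
    using *[of "\<^bold>\<forall>\<m>. \<^bold>\<forall>\<n>. (Add (Var \<m>) One \<^bold>= Add (Var \<n>) One \<^bold>\<longrightarrow> Var \<m> \<^bold>= Var \<n>)"]
    by (simp add: basic_axioms_def)
  then show "m \<oplus> one = n \<oplus> one \<longleftrightarrow> m = n" by blast
  show "m \<oplus> zero = m"
    using *[of "\<^bold>\<forall>\<m>. (Add (Var \<m>) Zero \<^bold>= Var \<m>)"] by (simp add: basic_axioms_def)
  show "m \<oplus> (n \<oplus> one) = m \<oplus> n \<oplus> one"
    using *[of "\<^bold>\<forall>\<m>. \<^bold>\<forall>\<n>. (Add (Var \<m>) (Add (Var \<n>) One) \<^bold>= Add (Add (Var \<m>) (Var \<n>)) One)"]
    by (simp add: basic_axioms_def)
  show "m \<otimes> zero = zero"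
    using *[of "\<^bold>\<forall>\<m>. (Mul (Var \<m>) Zero \<^bold>= Zero)"] by (simp add: basic_axioms_def)
  show "m \<otimes> (n \<oplus> one) = m \<otimes> n \<oplus> m"
    using *[of "\<^bold>\<forall>\<m>. \<^bold>\<forall>\<n>. (Mul (Var \<m>) (Add (Var \<n>) One) \<^bold>= Add (Mul (Var \<m>) (Var \<n>)) (Var \<m>))"]
    by (simp add: basic_axioms_def)
  show "\<not> m \<prec> zero"
    using *[of "\<^bold>\<forall>\<m>. \<^bold>\<not> (Var \<m> \<^bold>< Zero)"] by (simp add: basic_axioms_def)
  show "m \<prec> n \<oplus> one \<longleftrightarrow> m \<prec> n \<or> m = n"
    using *[of "\<^bold>\<forall>\<m>. \<^bold>\<forall>\<n>. (Var \<m> \<^bold>< Add (Var \<n>) One \<^bold>\<longleftrightarrow> (Var \<m> \<^bold>< Var \<n> \<^bold>\<or> Var \<m> \<^bold>= Var \<n>))"]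
    by (simp add: basic_axioms_def) blast
qed

text \<open>Convention for all uses: in \<open>\<phi>\<close>, \<open>Var 0\<close> is the unbounded
  witness, \<open>Var 1\<close> the induction variable, and the parameters in \<open>e\<close> start
  at \<open>Var 2\<close>. Formulas without a witness simply do not mention
  \<open>Var 0\<close>.\<close>

lemma Sigma01_induct:
  assumes \<phi>: "\<phi> \<in> Sigma00"
    and P: "\<And>n. P n \<longleftrightarrow> (\<exists>w. sat (case_nat w (case_nat n e)) E \<phi>)"
    and zero: "P zero" and step: "\<And>n. P n \<Longrightarrow> P (n \<oplus> one)"
  shows "P n"
proof -
  have "sat e E (induction_axiom (Ex \<phi>))"
    by (rule sat_if_closures[of _ e0 E0], rule sat_RCA0) (use \<phi> in \<open>auto simp: RCA0_def Sigma01_def\<close>)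
  moreover have "(\<lambda>i. evalt e (case_nat Zero Var i)) = case_nat zero e"
    by (auto simp: fun_eq_iff split: nat.split)
  moreover have "(\<lambda>i. evalt (case_nat m e) (case_nat (Add (Var 0) One) (\<lambda>i. Var (Suc i)) i))
      = case_nat (m \<oplus> one) e" for m
    by (auto simp: fun_eq_iff split: nat.split)
  ultimately have "P zero \<Longrightarrow> \<forall>n. P n \<longrightarrow> P (n \<oplus> one) \<Longrightarrow> \<forall>n. P n"
    unfolding induction_axiom_def P sat.simps sat_subst by simp
  then show ?thesis using zero step by blast
qed

abbreviation params2 :: "'n \<Rightarrow> 'n \<Rightarrow> nat \<Rightarrow> 'n" where
  "params2 a b \<equiv> case_nat a (case_nat b (\<lambda>_. zero))"

lemma zero_add: "zero \<oplus> n = n"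
  by (rule Sigma01_induct[where n = n and e = e0 and \<phi> = "Add Zero (Var 1) \<^bold>= Var 1"])
    (auto simp: basic intro: Sigma00.intros)

lemma add_Suc: "m \<oplus> one \<oplus> n = m \<oplus> n \<oplus> one"
  by (rule Sigma01_induct[where n = n and e = "params2 m m"
        and \<phi> = "Add (Add (Var 2) One) (Var 1) \<^bold>= Add (Add (Var 2) (Var 1)) One"])
    (auto simp: basic intro: Sigma00.intros)

lemma add_commute: "m \<oplus> n = n \<oplus> m"
  by (rule Sigma01_induct[where n = n and e = "params2 m m"
        and \<phi> = "Add (Var 2) (Var 1) \<^bold>= Add (Var 1) (Var 2)"])
    (auto simp: basic zero_add add_Suc intro: Sigma00.intros)

lemma add_assoc: "k \<oplus> m \<oplus> n = k \<oplus> (m \<oplus> n)"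
  by (rule Sigma01_induct[where n = n and e = "params2 k m"
        and \<phi> = "Add (Add (Var 2) (Var 3)) (Var 1) \<^bold>= Add (Var 2) (Add (Var 3) (Var 1))"])
    (auto simp: basic intro: Sigma00.intros)

lemma add_left_commute: "k \<oplus> (m \<oplus> n) = m \<oplus> (k \<oplus> n)"
  by (metis add_assoc add_commute)

lemmas add_ac = add_assoc add_commute add_left_commute

lemma zero_mul: "zero \<otimes> n = zero"
  by (rule Sigma01_induct[where n = n and e = e0 and \<phi> = "Mul Zero (Var 1) \<^bold>= Zero"])
    (auto simp: basic intro: Sigma00.intros)

lemma mul_Suc: "(m \<oplus> one) \<otimes> n = m \<otimes> n \<oplus> n"
  by (rule Sigma01_induct[where n = n and e = "params2 m m"
        and \<phi> = "Mul (Add (Var 2) One) (Var 1) \<^bold>= Add (Mul (Var 2) (Var 1)) (Var 1)"])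
    (auto simp: basic(3,5,6) add_ac intro: Sigma00.intros)

lemma mul_commute: "m \<otimes> n = n \<otimes> m"
  by (rule Sigma01_induct[where n = n and e = "params2 m m"
        and \<phi> = "Mul (Var 2) (Var 1) \<^bold>= Mul (Var 1) (Var 2)"])
    (auto simp: basic zero_mul mul_Suc intro: Sigma00.intros)

lemma distrib_left: "k \<otimes> (m \<oplus> n) = k \<otimes> m \<oplus> k \<otimes> n"
  by (rule Sigma01_induct[where n = n and e = "params2 k m"
        and \<phi> = "Mul (Var 2) (Add (Var 3) (Var 1)) \<^bold>= Add (Mul (Var 2) (Var 3)) (Mul (Var 2) (Var 1))"])
    (auto simp: basic(3-6) add_assoc[symmetric] intro: Sigma00.intros)

lemma mul_one: "m \<otimes> one = m"
  by (metis basic(5,6) zero_add)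

lemma distrib_right: "(m \<oplus> n) \<otimes> k = m \<otimes> k \<oplus> n \<otimes> k"
  by (metis distrib_left mul_commute)

lemma add_right_cancel: "m \<oplus> n = k \<oplus> n \<longleftrightarrow> m = k"
proof -
  have "m \<oplus> n = k \<oplus> n \<longrightarrow> m = k"
    by (rule Sigma01_induct[where n = n and e = "params2 m k"
          and \<phi> = "Add (Var 2) (Var 1) \<^bold>= Add (Var 3) (Var 1) \<^bold>\<longrightarrow> Var 2 \<^bold>= Var 3"])
      (auto simp: basic(2-4) intro: Sigma00.intros)
  then show ?thesis by blast
qed

lemma add_left_cancel: "n \<oplus> m = n \<oplus> k \<longleftrightarrow> m = k"
  by (metis add_commute add_right_cancel)

lemma add_Suc_neq: "m \<oplus> (n \<oplus> one) \<noteq> m"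
  using add_left_cancel[of m "n \<oplus> one" zero] by (simp add: basic)

section \<open>The order of the model\<close>

lemma lt_add_Suc: "m \<prec> m \<oplus> (n \<oplus> one)"
  by (rule Sigma01_induct[where n = n and e = "params2 m m"
        and \<phi> = "Var 2 \<^bold>< Add (Var 2) (Add (Var 1) One)"])
    (auto simp: basic intro: Sigma00.intros)

lemma lt_iff: "m \<prec> n \<longleftrightarrow> (\<exists>d. n = m \<oplus> (d \<oplus> one))"
proof -
  \<comment> \<open>The quantifier over the difference is pulled in front of the implication, so
    that the matrix is bounded and \<open>Var 0\<close> can stand for \<open>d\<close>.\<close>
  have "\<exists>d. m \<prec> n \<longrightarrow> n = m \<oplus> (d \<oplus> one)"
  proof (rule Sigma01_induct[where n = n and e = "params2 m m"
        and \<phi> = "Var 2 \<^bold>< Var 1 \<^bold>\<longrightarrow> Var 1 \<^bold>= Add (Var 2) (Add (Var 0) One)"])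
    fix n assume "\<exists>d. m \<prec> n \<longrightarrow> n = m \<oplus> (d \<oplus> one)"
    then show "\<exists>d. m \<prec> n \<oplus> one \<longrightarrow> n \<oplus> one = m \<oplus> (d \<oplus> one)"
      by (metis basic(4,8) zero_add)
  qed (auto simp: basic(7) intro: Sigma00.intros)
  then show ?thesis using lt_add_Suc by blast
qed

lemma zero_or_Suc: "n = zero \<or> (\<exists>d. n = d \<oplus> one)"
proof -
  have "\<exists>d. n = zero \<or> n = d \<oplus> one"
    by (rule Sigma01_induct[where n = n and e = e0
          and \<phi> = "Var 1 \<^bold>= Zero \<^bold>\<or> Var 1 \<^bold>= Add (Var 0) One"])
      (auto intro: Sigma00.intros)
  then show ?thesis by blast
qed

lemma lt_linear: "m \<prec> n \<or> m = n \<or> n \<prec> m"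
proof (rule Sigma01_induct[where P = "\<lambda>n. m \<prec> n \<or> m = n \<or> n \<prec> m" and e = "params2 m m"
      and \<phi> = "Var 2 \<^bold>< Var 1 \<^bold>\<or> Var 2 \<^bold>= Var 1 \<^bold>\<or> Var 1 \<^bold>< Var 2"])
  show "m \<prec> zero \<or> m = zero \<or> zero \<prec> m"
    using zero_or_Suc[of m] by (auto simp: lt_iff zero_add)
  show "m \<prec> n \<oplus> one \<or> m = n \<oplus> one \<or> n \<oplus> one \<prec> m" if "m \<prec> n \<or> m = n \<or> n \<prec> m" for n
  proof -
    have "m = n \<oplus> one \<or> n \<oplus> one \<prec> m" if n: "n \<prec> m"
    proof -
      obtain d where d: "m = n \<oplus> (d \<oplus> one)" using n lt_iff by blast
      show ?thesis
        using zero_or_Suc[of d]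
      proof
        assume "d = zero"
        then show ?thesis by (simp add: d zero_add)
      next
        assume "\<exists>d'. d = d' \<oplus> one"
        then show ?thesis unfolding d lt_iff by (metis add_assoc add_commute)
      qed
    qed
    with that show ?thesis by (auto simp: basic)
  qed
qed (auto intro: Sigma00.intros)

lemma lt_irrefl: "\<not> m \<prec> m"
  using add_Suc_neq unfolding lt_iff by metis

section \<open>Injectivity of the pairing function\<close>

definition pair :: "'n \<Rightarrow> 'n \<Rightarrow> 'n" where
  "pair i j = (i \<oplus> j) \<otimes> (i \<oplus> j) \<oplus> i"

lemma evalt_pr [simp]: "evalt e (pr s t) = pair (evalt e s) (evalt e t)"
  by (simp add: pr_def pair_def)

text \<open>Codes of pairs with sum \<open>s\<close> lie between \<open>s^2\<close> and
  \<open>s^2 + s\<close>, hence below \<open>(s + 1)^2\<close>; a larger sum thus forces a larger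
  code.\<close>

lemma pair_sum_not_lt:
  assumes "pair i j = pair i' j'"
  shows "\<not> i \<oplus> j \<prec> i' \<oplus> j'"
proof
  assume "i \<oplus> j \<prec> i' \<oplus> j'"
  then obtain d where d: "i' \<oplus> j' = i \<oplus> j \<oplus> (d \<oplus> one)" unfolding lt_iff by blast
  define s where "s = i \<oplus> j"
  \<comment> \<open>There is no subtraction, so the excess of the larger code is written out: with
    \<open>i' + j' = s + d + 1\<close>, the right-hand code exceeds the left-hand one by exactly
    \<open>q + 1\<close>. One copy of \<open>s\<close> in the expanded square is split as
    \<open>i + j\<close> to absorb \<open>i\<close>.\<close>
  define q where "q = s \<otimes> d \<oplus> s \<oplus> d \<otimes> s \<oplus> d \<otimes> d \<oplus> d \<oplus> j \<oplus> d \<oplus> i'"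
  have "s \<otimes> s \<oplus> i = (s \<oplus> (d \<oplus> one)) \<otimes> (s \<oplus> (d \<oplus> one)) \<oplus> i'"
    using assms unfolding pair_def d s_def .
  also have "\<dots> = s \<otimes> s \<oplus> (i \<oplus> (q \<oplus> one))"
    by (simp add: q_def s_def add_ac distrib_left distrib_right mul_commute mul_one)
  finally show False
    by (metis add_left_cancel add_Suc_neq)
qed

lemma pair_inject: "pair i j = pair i' j' \<longleftrightarrow> i = i' \<and> j = j'"
proof
  assume eq: "pair i j = pair i' j'"
  then have "i \<oplus> j = i' \<oplus> j'" using pair_sum_not_lt lt_linear by metis
  with eq show "i = i' \<and> j = j'"
    unfolding pair_def by (metis add_left_cancel)
qed simp


text \<open>Lets one unbounded quantifier over \<open>q\<close> replace three: norm, index and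
  member become bounded by \<open>q\<close>.\<close>

lemma common_bound: "\<exists>q. j \<prec> q \<and> m \<prec> q \<and> a \<prec> q"
proof (intro exI conjI)
  let ?q = "j \<oplus> m \<oplus> a \<oplus> one"
  have "?q = j \<oplus> (m \<oplus> a \<oplus> one)" "?q = m \<oplus> (j \<oplus> a \<oplus> one)" "?q = a \<oplus> (j \<oplus> m \<oplus> one)"
    by (simp_all add: add_ac)
  then show "j \<prec> ?q" "m \<prec> ?q" "a \<prec> ?q" using lt_add_Suc by metis+
qed

text \<open>
  The least number principle for a \<open>\<Sigma>\<^sup>0\<^sub>1\<close> property \<open>Q\<close> follows from \<open>\<Sigma>\<^sup>0\<^sub>1\<close> induction on \<open>k\<close> applied to
  \<open>\<exists>j. j + k \<le> j\<^sub>0 \<and> Q j\<close>: if no \<open>j\<close> were least, this would hold for all \<open>k\<close>.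
\<close>

lemma least_value:
  fixes F I :: 's and z :: 'n
  defines "Q \<equiv> \<lambda>j. \<exists>m a. mem (pair m a) I \<and> mem (pair a j) F \<and> a \<noteq> z"
  assumes "Q j0"
  shows "\<exists>j. Q j \<and> (\<forall>i. i \<prec> j \<longrightarrow> \<not> Q i)"
proof (rule ccontr)
  assume no_least: "\<not> ?thesis"
  \<comment> \<open>In the innermost scope, indices 0 to 6 are the member \<open>a\<close>, its
    index \<open>m\<close>, its norm \<open>j\<close>, the common bound, \<open>k\<close>,
    \<open>j0\<close> and \<open>z\<close>; set 0 is the norm and set 1 the sequence. Comparison
    with \<open>j0 + 1\<close> expresses the weak inequality.\<close>
  define \<phi> where "\<phi> =
    Ex (Var 0 \<^bold>< shiftt (Var 0) \<^bold>\<and> Ex (Var 0 \<^bold>< shiftt (Var 1) \<^bold>\<and> Ex (Var 0 \<^bold>< shiftt (Var 2) \<^bold>\<and>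
      (Add (Var 2) (Var 4) \<^bold>< Add (Var 5) One \<^bold>\<and>
       pr (Var 1) (Var 0) \<^bold>\<in> 1 \<^bold>\<and> pr (Var 0) (Var 2) \<^bold>\<in> 0 \<^bold>\<and> \<^bold>\<not> (Var 0 \<^bold>= Var 6)))))"
  have "\<exists>j. j \<oplus> k \<prec> j0 \<oplus> one \<and> Q j" for k
  proof (rule Sigma01_induct[where P = "\<lambda>k. \<exists>j. j \<oplus> k \<prec> j0 \<oplus> one \<and> Q j"
        and \<phi> = \<phi> and e = "params2 j0 z" and E = "case_nat F (\<lambda>_. I)"])
    show "\<phi> \<in> Sigma00"
      unfolding \<phi>_def by (rule Sigma00.intros(7))+ (intro Sigma00.intros)
    show "(\<exists>j. j \<oplus> k \<prec> j0 \<oplus> one \<and> Q j) \<longleftrightarrow>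
        (\<exists>q. sat (case_nat q (case_nat k (params2 j0 z))) (case_nat F (\<lambda>_. I)) \<phi>)" for k
      unfolding \<phi>_def Q_def by simp (use common_bound in blast)
    show "\<exists>j. j \<oplus> zero \<prec> j0 \<oplus> one \<and> Q j"
      using assms(2) by (auto simp: basic)
    show "\<exists>j. j \<oplus> (k \<oplus> one) \<prec> j0 \<oplus> one \<and> Q j" if k: "\<exists>j. j \<oplus> k \<prec> j0 \<oplus> one \<and> Q j" for k
    proof -
      obtain j where j: "j \<oplus> k \<prec> j0 \<oplus> one" "Q j" using k by blast
      obtain i where i: "i \<prec> j" "Q i" using no_least j(2) by blast
      obtain c d where "j0 \<oplus> one = j \<oplus> k \<oplus> (c \<oplus> one)" "j = i \<oplus> (d \<oplus> one)"
        using j(1) i(1) unfolding lt_iff by blast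
      then have "j0 \<oplus> one = i \<oplus> (k \<oplus> one) \<oplus> ((d \<oplus> c) \<oplus> one)"
        by (simp add: add_ac)
      then show ?thesis using i(2) lt_add_Suc by metis
    qed
  qed
  \<comment> \<open>The instance at \<open>k = j0 + 1\<close>, which leaves no room for any
    \<open>j\<close>.\<close>
  then obtain j d where "j0 \<oplus> one = j \<oplus> (j0 \<oplus> one) \<oplus> (d \<oplus> one)"
    unfolding lt_iff by blast
  moreover have "j \<oplus> (j0 \<oplus> one) \<oplus> (d \<oplus> one) = j0 \<oplus> one \<oplus> ((j \<oplus> d) \<oplus> one)"
    by (simp add: add_ac)
  ultimately show False using add_Suc_neq by metis
qed


section \<open>Reading the ring formulas in a model\<close>

lemma sat_Con: "sat e E (\<phi> \<^bold>\<and> \<psi>) \<longleftrightarrow> sat e E \<phi> \<and> sat e E \<psi>"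
  by simp

lemma sat_Dis: "sat e E (\<phi> \<^bold>\<or> \<psi>) \<longleftrightarrow> sat e E \<phi> \<or> sat e E \<psi>"
  by auto

lemma sat_Iff: "sat e E (\<phi> \<^bold>\<longleftrightarrow> \<psi>) \<longleftrightarrow> (sat e E \<phi> \<longleftrightarrow> sat e E \<psi>)"
  by auto

lemma sat_exn: "sat e E (\<^bold>\<exists>x. \<phi>) \<longleftrightarrow> (\<exists>v. sat (e(x := v)) E \<phi>)"
  by simp

lemma sat_exs: "sat e E (\<^bold>\<exists>\<^sub>SX. \<phi>) \<longleftrightarrow> (\<exists>V. sat e (E(X := V)) \<phi>)"
  by simp

lemmas sat_rules = sat_Con sat_Dis sat_Iff sat_exn sat_exs sat_alln sat_alls

text \<open>\<open>D\<close> and \<open>C\<close> are read in the environment left by the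
  quantifiers of \<open>is_function\<close>: index 15 holds the argument, 16 the value and 9 the
  code of the pair. Injectivity of pairing recovers the argument and the value from that
  code.\<close>

lemma sat_is_functionD:
  assumes "sat e E (is_function F D C)"
  shows "mem (pair x y) (E F) \<Longrightarrow> \<exists>p. sat (e(9 := p, 15 := x, 16 := y)) E (D 15) \<and>
      sat (e(9 := p, 15 := x, 16 := y)) E (C 16)"
    and "sat (e(15 := x)) E (D 15) \<Longrightarrow> \<exists>y. mem (pair x y) (E F)"
    and "mem (pair x u) (E F) \<Longrightarrow> mem (pair x v) (E F) \<Longrightarrow> u = v"
proof -
  note conj = assms[unfolded is_function_def app1_def sat_Con]
  show "\<exists>p. sat (e(9 := p, 15 := x, 16 := y)) E (D 15) \<and> sat (e(9 := p, 15 := x, 16 := y)) E (C 16)"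
    if "mem (pair x y) (E F)"
    using conj[THEN conjunct1] that by (simp add: sat_rules) (metis pair_inject)
  show "\<exists>y. mem (pair x y) (E F)" if "sat (e(15 := x)) E (D 15)"
    using conj[THEN conjunct2, THEN conjunct1] that by simp
  show "u = v" if "mem (pair x u) (E F)" "mem (pair x v) (E F)"
    using conj[THEN conjunct2, THEN conjunct2] that by simp
qed

lemmas sat_defs = in_ideal_def in_principal_def lincomb_def app1_def app2_def
  inR_def inRR_def inNat_def

lemma nat_eq_False:
  "numeral k = (0 :: nat) \<longleftrightarrow> False" "(0 :: nat) = numeral k \<longleftrightarrow> False"
  "(0 :: nat) = 1 \<longleftrightarrow> False" "(1 :: nat) = 0 \<longleftrightarrow> False"
  by simp_all

text \<open>Rewrites a concrete formula into a plain statement about the model; the numeral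
  comparisons decide which update of the environment a variable reads.\<close>

lemmas sat_eval = sat_rules sat_defs sat.simps evalt.simps evalt_pr fun_upd_apply rel_simps
  nat_eq_False one_eq_numeral_iff numeral_eq_one_iff
  not_all not_imp if_True if_False simp_thms

lemma ideal_is_principal:
  assumes dom: "sat e E is_integral_domain" and norm: "sat e E is_DH_norm"
    and ideal: "sat e E is_Sigma01_ideal"
  shows "sat e E ideal_is_principal"
proof -
  define R where "R x \<longleftrightarrow> mem x (E 0)" for x
  define A where "A x y w \<longleftrightarrow> mem (pair (pair x y) w) (E 1)" for x y w
  define N where "N x y \<longleftrightarrow> mem (pair x y) (E 2)" for x y
  define M where "M x y w \<longleftrightarrow> mem (pair (pair x y) w) (E 3)" for x y w
  define F where "F x y \<longleftrightarrow> mem (pair x y) (E 4)" for x y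
  define I where "I x y \<longleftrightarrow> mem (pair x y) (E 5)" for x y
  define z where "z = e 17"
  note folds = R_def[symmetric] A_def[symmetric] N_def[symmetric] M_def[symmetric]
    F_def[symmetric] I_def[symmetric] z_def[symmetric]
  note ring = dom[unfolded is_integral_domain_def is_comm_ring_def sat_Con]
  note norm = norm[unfolded is_DH_norm_def sat_Con]
  note ideal = ideal[unfolded is_Sigma01_ideal_def sat_Con]
  have fA: "sat e E (is_function 1 inRR inR)" and fN: "sat e E (is_function 2 inR inR)"
    and fM: "sat e E (is_function 3 inRR inR)"
    using ring by blast+
  have fF: "sat e E (is_function 4 inR inNat)" using norm by blast
  have fI: "sat e E (is_function 5 inNat inR)" using ideal by blast
  have A_total: "\<exists>w. R w \<and> A x y w" if xy: "R x" "R y" for x y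
  proof -
    obtain w where "A x y w"
      using sat_is_functionD(2)[OF fA, of "pair x y", unfolded sat_eval folds] xy by blast
    then show ?thesis
      using sat_is_functionD(1)[OF fA, of "pair x y" w, unfolded sat_eval folds] by blast
  qed
  have M_total: "\<exists>w. R w \<and> M x y w" if xy: "R x" "R y" for x y
  proof -
    obtain w where "M x y w"
      using sat_is_functionD(2)[OF fM, of "pair x y", unfolded sat_eval folds] xy by blast
    then show ?thesis
      using sat_is_functionD(1)[OF fM, of "pair x y" w, unfolded sat_eval folds] by blast
  qed
  have N_total: "\<exists>w. R w \<and> N x w" if x: "R x" for x
  proof -
    obtain w where "N x w"
      using sat_is_functionD(2)[OF fN, of x, unfolded sat_eval folds] x by blast
    then show ?thesis
      using sat_is_functionD(1)[OF fN, of x w, unfolded sat_eval folds] by blast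
  qed
  have F_total: "\<exists>w. F x w" if "R x" for x
    using sat_is_functionD(2)[OF fF, of x, unfolded sat_eval folds] that by blast
  have A_fun: "A x y u \<Longrightarrow> A x y v \<Longrightarrow> u = v" for x y u v
    unfolding A_def by (rule sat_is_functionD(3)[OF fA])
  have M_fun: "M x y u \<Longrightarrow> M x y v \<Longrightarrow> u = v" for x y u v
    unfolding M_def by (rule sat_is_functionD(3)[OF fM])
  have F_fun: "F x u \<Longrightarrow> F x v \<Longrightarrow> u = v" for x u v
    unfolding F_def by (rule sat_is_functionD(3)[OF fF])
  have I_fun: "I x u \<Longrightarrow> I x v \<Longrightarrow> u = v" for x u v
    unfolding I_def by (rule sat_is_functionD(3)[OF fI])
  have I_total: "\<exists>y. I x y" for x
    using sat_is_functionD(2)[OF fI, of x, unfolded sat_eval folds] by blast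
  have I_R: "R y" if "I x y" for x y
    using sat_is_functionD(1)[OF fI, of x y, unfolded sat_eval folds] that by blast
  have R_z: "R z"
    using ring by (simp only: inR_def sat.simps evalt.simps R_def z_def)
  note axioms = ring[THEN conjunct1, THEN conjunct2, THEN conjunct2, THEN conjunct2,
      THEN conjunct2, THEN conjunct2]
  have A_assoc: "A a v w" if "R a" "R b" "R c" "R u" "R v" "R w" "A a b u" "A u c w" "A b c v"
    for a b c u v w
    using axioms[THEN conjunct1, unfolded sat_eval folds] that by blast
  note axioms = axioms[THEN conjunct2, THEN conjunct2]
  have A_z: "A a z a" if "R a" for a
    using axioms[THEN conjunct1, unfolded sat_eval folds] that by blast
  note axioms = axioms[THEN conjunct2]
  have A_N: "A a u z" if "R a" "R u" "N a u" for a u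
    using axioms[THEN conjunct1, unfolded sat_eval folds] that by blast
  note axioms = axioms[THEN conjunct2, THEN conjunct2]
  have M_comm: "M b a u" if "R a" "R b" "R u" "M a b u" for a b u
    using axioms[THEN conjunct1, unfolded sat_eval folds] that by blast
  note axioms = axioms[THEN conjunct2, THEN conjunct2]
  have distrib: "A v w x" if "R a" "R b" "R c" "R u" "R v" "R w" "R x"
    "A b c u" "M a u x" "M a b v" "M a c w" for a b c u v w x
    using axioms[unfolded sat_eval folds] that by blast
  have F_z: "F r zero \<longleftrightarrow> r = z" if "R r" for r
    using norm[THEN conjunct2, THEN conjunct1, unfolded sat_eval folds] that by blast
  have DH: "(\<exists>x. R x \<and> M b x a) \<or> (\<exists>x y w u v m n. R x \<and> R y \<and> R w \<and> R u \<and> R v \<and>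
      M a x u \<and> M b y v \<and> A u v w \<and> F w m \<and> F b n \<and> zero \<prec> m \<and> m \<prec> n)"
    if "R a" "R b" "a \<noteq> z" "b \<noteq> z" for a b
    using norm[THEN conjunct2, THEN conjunct2, THEN conjunct1, unfolded sat_eval folds] that by blast
  \<comment> \<open>The ideal formula picks its own values at \<open>i\<close> and \<open>j\<close>;
    single-valuedness of the sequence identifies them with \<open>a\<close> and
    \<open>b\<close>.\<close>
  have I_comb: "\<exists>k c u v. I k c \<and> R u \<and> R v \<and> M a r u \<and> M b s v \<and> A u v c"
    if "I i a" "I j b" "R r" "R s" for i j a b r s
  proof -
    have "\<exists>k a' b' c u v. I i a' \<and> I j b' \<and> I k c \<and> R u \<and> R v \<and> M a' r u \<and> M b' s v \<and> A u v c"
      using ideal[THEN conjunct2, unfolded sat_eval folds] that(3,4) by blast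
    then show ?thesis using I_fun that(1,2) by metis
  qed
  have principal: ?thesis
    if "R c" "\<And>i x. I i x \<Longrightarrow> \<exists>r. R r \<and> M c r x" "\<And>x r. R x \<Longrightarrow> R r \<Longrightarrow> M c r x \<Longrightarrow> \<exists>i. I i x" for c
    unfolding ideal_is_principal_def sat_eval folds using that by blast
  \<comment> \<open>For \<open>v = b0\<close>, distributivity over \<open>0 + 0 = 0\<close> gives
    \<open>v + v = v\<close>; adding the negative of \<open>v\<close> yields
    \<open>v = 0\<close>.\<close>
  have M_z: "M b z z" if "R b" for b
  proof -
    obtain v where v: "R v" "M b z v" using M_total \<open>R b\<close> R_z by blast
    obtain n where n: "R n" "N v n" using N_total v(1) by blast
    have "A v v v" by (rule distrib[of b z z z v v v]) (use v \<open>R b\<close> R_z A_z in auto)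
    moreover have "A v n z" using A_N v(1) n by blast
    ultimately have "A v z z" using A_assoc[of v v n v z z] v(1) n(1) R_z by blast
    then have "v = z" using A_z[OF v(1)] A_fun by blast
    with v(2) show ?thesis by simp
  qed
  show ?thesis
  proof (cases "\<exists>i x. I i x \<and> x \<noteq> z")
    case False
    show ?thesis
    proof (rule principal[of z])
      show "\<exists>r. R r \<and> M z r x" if "I i x" for i x
        using False that M_z R_z by blast
      show "\<exists>i. I i x" if "R x" "R r" "M z r x" for x r
      proof -
        have "x = z" using M_fun M_comm[of r z z] M_z[of r] that R_z by blast
        \<comment> \<open>The sequence is total, so the ideal is nonempty, and in this case its only
          member is zero.\<close>
        moreover obtain y where "I zero y" using I_total by blast
        ultimately show ?thesis using False by blast
      qed
    qed (rule R_z)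
  next
    case True
    then obtain i x j where "I i x" "x \<noteq> z" "F x j" using F_total I_R by blast
    then obtain n m c where c: "I m c" "F c n" "c \<noteq> z"
      and least: "\<And>n' i x. n' \<prec> n \<Longrightarrow> I i x \<Longrightarrow> F x n' \<Longrightarrow> x = z"
      using least_value[where I = "E 5" and F = "E 4" and z = z and ?j0.0 = j] unfolding I_def F_def by blast
    show ?thesis
    proof (rule principal[of c])
      show "R c" using c(1) by (rule I_R)
      show "\<exists>r. R r \<and> M c r x" if ix: "I i x" for i x
      proof (cases "x = z")
        case True
        then show ?thesis using M_z \<open>R c\<close> R_z by blast
      next
        case False
        show ?thesis
        proof (rule ccontr)
          assume "\<not> ?thesis"
          then obtain s t w u v k l where
            *: "R s" "R t" "R w" "M x s u" "M c t v" "A u v w" "F w k" "F c l" "zero \<prec> k" "k \<prec> l"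
            using DH[OF I_R[OF ix] \<open>R c\<close> False c(3)] by blast
          have "l = n" using F_fun *(8) c(2) by blast
          \<comment> \<open>Closure of the ideal under the very coefficients from the Dedekind-Hasse
            property; single-valuedness of the operations makes \<open>c'\<close> equal to
            \<open>w\<close>.\<close>
          obtain i' c' u' v' where "I i' c'" "M x s u'" "M c t v'" "A u' v' c'"
            using I_comb[OF ix c(1) *(1,2)] by blast
          then have "I i' w" using M_fun A_fun *(4-6) by metis
          \<comment> \<open>Minimality leaves only zero among members of norm below
            \<open>n\<close>, but zero has norm zero while \<open>k\<close> is positive.\<close>
          then have "w = z" using least \<open>l = n\<close> *(7,10) by blast
          then have "F w zero" using F_z R_z by blast
          then have "k = zero" using F_fun *(7) by blast
          then show False using *(9) lt_irrefl by blast
        qed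
      qed
      show "\<exists>i. I i x" if "R x" "R r" "M c r x" for x r
      proof -
        \<comment> \<open>A multiple of \<open>c\<close> is written as the combination
          \<open>cr + c0\<close>, the shape under which the ideal is closed.\<close>
        obtain k y u v where "I k y" "M c r u" "M c z v" "A u v y"
          using I_comb[OF c(1) c(1) \<open>R r\<close> R_z] by blast
        moreover from this have "u = x" "v = z"
          using M_fun \<open>M c r x\<close> M_z[OF \<open>R c\<close>] by blast+
        ultimately show ?thesis using A_fun A_z[OF \<open>R x\<close>] by blast
      qed
    qed
  qed
qed

text \<open>The norm is quantified only around its own formula, and the sequence only around the
  ideal, so the two occur in different environments. Both are placed in one environment, and the
  free set variables show that each formula keeps its truth value there.\<close>

lemma sat_every_DH_domain_is_PID: "sat e E every_DH_domain_is_PID"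
proof -
  note fvS_defs = is_integral_domain_def is_comm_ring_def is_function_def is_DH_norm_def
    is_Sigma01_ideal_def ideal_is_principal_def sat_defs alln_def pr_def
  have fvS: "5 \<notin> fvS is_DH_norm" "fvS is_integral_domain \<inter> {4, 5} = {}"
    "4 \<notin> fvS is_Sigma01_ideal" "4 \<notin> fvS ideal_is_principal"
    by (simp_all add: fvS_defs)
  have "sat e E is_Sigma01_PID" if DH: "sat e E is_DH_domain" for e E
  proof -
    obtain F where dom: "sat e E is_integral_domain" and norm: "sat e (E(4 := F)) is_DH_norm"
      using DH unfolding is_DH_domain_def sat_rules by blast
    have "sat e (E(5 := I)) ideal_is_principal" if ideal: "sat e (E(5 := I)) is_Sigma01_ideal" for I
    proof -
      let ?E = "E(4 := F, 5 := I)"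
      have "sat e ?E is_integral_domain \<longleftrightarrow> sat e E is_integral_domain"
        "sat e ?E is_DH_norm \<longleftrightarrow> sat e (E(4 := F)) is_DH_norm"
        "sat e ?E is_Sigma01_ideal \<longleftrightarrow> sat e (E(5 := I)) is_Sigma01_ideal"
        "sat e ?E ideal_is_principal \<longleftrightarrow> sat e (E(5 := I)) ideal_is_principal"
        using fvS by (auto intro!: sat_cong)
      then show ?thesis using ideal_is_principal dom norm ideal by blast
    qed
    with dom show ?thesis unfolding is_Sigma01_PID_def sat_rules sat.simps by blast
  qed
  then show ?thesis unfolding every_DH_domain_is_PID_def sat_rules sat.simps by blast
qed

end

theorem theorem6p28:
  shows "RCA0 \<turnstile> every_DH_domain_is_PID"
proof (rule completeness)
  show "almost_closed RCA0" by (rule almost_closed_RCA0)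
  show "basic_axioms \<subseteq> RCA0" by (auto simp: RCA0_def)
next
  fix zero one add mul lt and mem :: "nat \<Rightarrow> nat \<Rightarrow> bool" and e E
  assume "\<And>\<gamma>. \<gamma> \<in> RCA0 \<Longrightarrow> L2_structure.sat zero one add mul lt mem e E \<gamma>"
  then interpret RCA0_model zero one add mul lt mem e E by (rule RCA0_model.intro)
  show "L2_structure.sat zero one add mul lt mem e E every_DH_domain_is_PID"
    by (rule sat_every_DH_domain_is_PID)
qed

end
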